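(* Let $(a_{n,m}),(b_{n,m}),(q_{n,m})$, $(n,m)\in\mathbb{Z}_+^2$, be families of real numbers with $a_{0,m}=b_{n,0}=0$ for all $n,m\ge 0$, $a_{n,0}>0$ for $n>0$, $b_{0,m}>0$ for $m>0$, $a_{n,m}\ne 0$ for $n\ge 1$, $b_{n,m}\neq 0$ for $m\ge1$, and $q_{n+1,m}\ne q_{n,m+1}$ for all $n,m\ge 0$. Let $\widetilde{\Delta}$ be the cross-shaped difference operator $$(\widetilde{\Delta} f)_{n,m}=\tfrac12 f_{n+1,m}+\tfrac12 f_{n,m+1}+q_{n,m}f_{n,m}+a_{n,m}f_{n-1,m}+b_{n,m}f_{n,m-1},\qquad (n,m)\in\mathbb{Z}_+^2,$$ (with $f_{-1,m}=f_{n,-1}=0$), and suppose that $$D_{n,m}:=-4\left(\frac{a_{n+1,m+1}}{a_{n+1,m}}+\frac{b_{n+1,m+1}}{b_{n,m+1}}\right)+8\neq 0\qquad\text{for all } n,m\ge 0.$$ Then the following are equivalent: (1) The eigenvalue problem $\widetilde{\Delta}\xi(z)=z\,\xi(z)$ has a family of multiple orthogonal polynomials as its solution, i.e. there exist positive measures $\mu_1,\mu_2$ on $\mathbb{R}$ with all moments finite, for which all multi-indices in $\mathbb{Z}_+^2$ are normal, such that $\xi(z)=(P_{n,m}(z))_{(n,m)\in\mathbb{Z}_+^2}$, with $P_{n,m}$ the type II multiple orthogonal polynomials for $(\mu_1,\mu_2)$, satisfies $\widetilde{\Delta}\xi(z)=z\,\xi(z)$ for all $z$. (2) The discrete zero curvature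 condition $$L_{n,m+1}M_{n,m}-M_{n+1,m}L_{n,m}=0,\qquad n,m\in\mathbb{Z}_+,$$ holds identically in $z$, where $$L_{n,m}=\begin{pmatrix} z-q_{n,m}+4\frac{q_{n+1,m}}{D_{n,m}}-4\frac{q_{n,m+1}}{D_{n,m}} & -a_{n,m} & -b_{n,m}\\ 1&0&0\\ 1&0&8\left(\frac{q_{n+1,m-1}}{D_{n,m-1}}-\frac{q_{n,m}}{D_{n,m-1}}\right)\end{pmatrix},$$ $$M_{n,m}=\begin{pmatrix} z-q_{n,m}-4\frac{q_{n+1,m}}{D_{n,m}}+4\frac{q_{n,m+1}}{D_{n,m}} & -a_{n,m} & -b_{n,m}\\ 1&-8\left(\frac{q_{n,m}}{D_{n-1,m}}-\frac{q_{n-1,m+1}}{D_{n-1,m}}\right)&0\\ 1&0&0\end{pmatrix},$$ and, by convention, the $(3,3)$ entry of $L_{n,0}$ and the $(2,2)$ entry of $M_{0,m}$ are $0$.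
   Context: $\mathbb{Z}_+=\{0,1,2,\dots\}$. For two positive measures $\mu_1,\mu_2$ on $\mathbb{R}$ with all moments finite, the type II multiple orthogonal polynomial $P_{n,m}$ is the monic polynomial of degree $n+m$ with $\int P_{n,m}(x)x^j\,d\mu_1(x)=0$ for $0\le j\le n-1$ and $\int P_{n,m}(x)x^j\,d\mu_2(x)=0$ for $0\le j\le m-1$. The multi-index $(n,m)$ is normal if the determinant $S_{n,m}$ of the $(n+m)\times(n+m)$ moment matrix is nonzero; this matrix has rows $i=0,\dots,n+m-1$, and its $i$-th row is $(s^{(1)}_i,\dots,s^{(1)}_{i+n-1},s^{(2)}_i,\dots,s^{(2)}_{i+m-1})$, with $s^{(k)}_j=\int x^j\,d\mu_k$ (and $S_{0,0}=1$). Equivalently, $(n,m)$ is normal if $P_{n,m}$ exists and is unique. *)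

theory Defs
  imports "HOL-Analysis.Analysis" "Jordan_Normal_Form.Determinant"
begin

(* A positive Borel measure on the real line with all moments finite; the case j = 0
   makes it a finite measure. *)
definition finite_moments_measure :: "real measure \<Rightarrow> bool" where
  "finite_moments_measure \<mu> \<longleftrightarrow> sets \<mu> = sets borel \<and> (\<forall>j::nat. integrable \<mu> (\<lambda>x. x ^ j))"

definition moment :: "real measure \<Rightarrow> nat \<Rightarrow> real" where
  "moment \<mu> j = (\<integral>x. x ^ j \<partial>\<mu>)"

definition moment_matrix :: "real measure \<Rightarrow> real measure \<Rightarrow> nat \<Rightarrow> nat \<Rightarrow> real Matrix.mat" where
  "moment_matrix \<mu>1 \<mu>2 n m = Matrix.mat (n + m) (n + m)
     (\<lambda>(i, j). if j < n then moment \<mu>1 (i + j) else moment \<mu>2 (i + (j - n)))"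

(* For n = m = 0 the determinant of the empty matrix is 1. *)
definition normal_index :: "real measure \<Rightarrow> real measure \<Rightarrow> nat \<Rightarrow> nat \<Rightarrow> bool" where
  "normal_index \<mu>1 \<mu>2 n m \<longleftrightarrow> Determinant.det (moment_matrix \<mu>1 \<mu>2 n m) \<noteq> 0"

definition type_II_mop ::
  "real measure \<Rightarrow> real measure \<Rightarrow> nat \<Rightarrow> nat \<Rightarrow> real poly \<Rightarrow> bool" where
  "type_II_mop \<mu>1 \<mu>2 n m P \<longleftrightarrow>
     degree P = n + m \<and> lead_coeff P = 1 \<and>
     (\<forall>j<n. (\<integral>x. poly P x * x ^ j \<partial>\<mu>1) = 0) \<and>
     (\<forall>j<m. (\<integral>x. poly P x * x ^ j \<partial>\<mu>2) = 0)"

(* The if-expressions implement f (-1) m = f n (-1) = 0. *)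
definition cross_diff_op ::
  "(nat \<Rightarrow> nat \<Rightarrow> real) \<Rightarrow> (nat \<Rightarrow> nat \<Rightarrow> real) \<Rightarrow> (nat \<Rightarrow> nat \<Rightarrow> real) \<Rightarrow>
   (nat \<Rightarrow> nat \<Rightarrow> complex) \<Rightarrow> nat \<Rightarrow> nat \<Rightarrow> complex" where
  "cross_diff_op a b q f n m =
     1/2 * f (n + 1) m + 1/2 * f n (m + 1) + of_real (q n m) * f n m
     + of_real (a n m) * (if n = 0 then 0 else f (n - 1) m)
     + of_real (b n m) * (if m = 0 then 0 else f n (m - 1))"

definition D_coeff ::
  "(nat \<Rightarrow> nat \<Rightarrow> real) \<Rightarrow> (nat \<Rightarrow> nat \<Rightarrow> real) \<Rightarrow> nat \<Rightarrow> nat \<Rightarrow> real" where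
  "D_coeff a b n m =
     - 4 * (a (n + 1) (m + 1) / a (n + 1) m + b (n + 1) (m + 1) / b n (m + 1)) + 8"

definition L_matrix ::
  "(nat \<Rightarrow> nat \<Rightarrow> real) \<Rightarrow> (nat \<Rightarrow> nat \<Rightarrow> real) \<Rightarrow> (nat \<Rightarrow> nat \<Rightarrow> real) \<Rightarrow>
   complex \<Rightarrow> nat \<Rightarrow> nat \<Rightarrow> complex Matrix.mat" where
  "L_matrix a b q z n m = mat_of_rows_list 3
     [[z - of_real (q n m) + of_real (4 * (q (n + 1) m / D_coeff a b n m))
         - of_real (4 * (q n (m + 1) / D_coeff a b n m)),
       - of_real (a n m), - of_real (b n m)],
      [1, 0, 0],
      [1, 0, if m = 0 then 0 else
         of_real (8 * (q (n + 1) (m - 1) / D_coeff a b n (m - 1)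
                       - q n m / D_coeff a b n (m - 1)))]]"

definition M_matrix ::
  "(nat \<Rightarrow> nat \<Rightarrow> real) \<Rightarrow> (nat \<Rightarrow> nat \<Rightarrow> real) \<Rightarrow> (nat \<Rightarrow> nat \<Rightarrow> real) \<Rightarrow>
   complex \<Rightarrow> nat \<Rightarrow> nat \<Rightarrow> complex Matrix.mat" where
  "M_matrix a b q z n m = mat_of_rows_list 3
     [[z - of_real (q n m) - of_real (4 * (q (n + 1) m / D_coeff a b n m))
         + of_real (4 * (q n (m + 1) / D_coeff a b n m)),
       - of_real (a n m), - of_real (b n m)],
      [1, if n = 0 then 0 else
         - of_real (8 * (q n m / D_coeff a b (n - 1) m
                         - q (n - 1) (m + 1) / D_coeff a b (n - 1) m)), 0],
      [1, 0, 0]]"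

end

theory Submission
  imports Defs "HOL-Probability.Helly_Selection"
    "HOL-Computational_Algebra.Fundamental_Theorem_Algebra"
begin

text \<open>
  Put \<open>h = -4 (q n+1,m - q n,m+1) / D n,m\<close>, \<open>c = q + h\<close> and \<open>d = q - h\<close>. Comparing entries, the zero
  curvature condition is the compatibility of the two nearest neighbour recurrences
  \<open>x P n,m = P n+1,m + c P n,m + a P n-1,m + b P n,m-1\<close> and
  \<open>x P n,m = P n,m+1 + d P n,m + a P n-1,m + b P n,m-1\<close>, whose mean is the eigenvalue equation.

  For multiple orthogonal polynomials, normality makes \<open>P n,m+1 - P n+1,m\<close> a nonzero multiple of
  \<open>P n,m\<close>, so the eigenvalue equation splits into two such recurrences; they are compatible, and
  compatibility forces the multiple to be \<open>2 h\<close>.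

  Conversely, compatible coefficients define a family \<open>P\<close> with \<open>P n,m+1 = P n+1,m + 2 h P n,m\<close>. By
  Favard's theorem its two boundary rows are orthogonal for measures \<open>\<mu>1\<close> and \<open>\<mu>2\<close> (obtained as
  Helly limits of Gauss quadratures), and orthogonality spreads along the relation just stated.
  All multi-indices are normal because \<open>\<integral> P n,m x^n d\<mu>1\<close> equals \<open>a n,m \<integral> P n-1,m x^(n-1) d\<mu>1\<close>, and
  for \<open>n = 0\<close> it is a product of factors \<open>2 h\<close>; similarly for \<open>\<mu>2\<close>.
\<close>

section \<open>Orthogonal polynomials and Gauss quadrature\<close>

text \<open>The moment functional is formal: in Favard's theorem the sequence \<open>s\<close> is
  known before any measure is.\<close>

definition poly_functional :: "(nat \<Rightarrow> real) \<Rightarrow> real poly \<Rightarrow> real" where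
  "poly_functional s p = (\<Sum>i\<le>degree p. coeff p i * s i)"

lemma poly_functional_eq_sum:
  assumes "\<And>i. i \<ge> N \<Longrightarrow> coeff p i = 0"
  shows "poly_functional s p = (\<Sum>i<N. coeff p i * s i)"
proof -
  have "poly_functional s p = (\<Sum>i\<in>{i. coeff p i \<noteq> 0}. coeff p i * s i)"
    unfolding poly_functional_def
    by (rule sum.mono_neutral_right) (auto simp: le_degree)
  also have "\<dots> = (\<Sum>i<N. coeff p i * s i)"
    by (rule sum.mono_neutral_left) (use assms in \<open>auto simp: not_le [symmetric]\<close>)
  finally show ?thesis .
qed

lemma poly_functional_eq_sum_degree:
  "degree p \<le> N \<Longrightarrow> poly_functional s p = (\<Sum>i<Suc N. coeff p i * s i)"
  by (rule poly_functional_eq_sum) (auto intro: coeff_eq_0)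

lemma poly_functional_add:
  "poly_functional s (p + r) = poly_functional s p + poly_functional s r"
proof -
  define N where "N = max (degree p) (degree r)"
  have "degree p \<le> N" "degree r \<le> N" "degree (p + r) \<le> N"
    using degree_add_le_max [of p r] by (auto simp: N_def)
  then show ?thesis
    by (simp only: poly_functional_eq_sum_degree coeff_add distrib_right sum.distrib)
qed

lemma poly_functional_smult: "poly_functional s (Polynomial.smult k p) = k * poly_functional s p"
  using degree_smult_le [of k p]
  by (simp only: poly_functional_eq_sum_degree poly_functional_eq_sum_degree [of p "degree p"]
      coeff_smult sum_distrib_left mult.assoc)

lemma poly_functional_0 [simp]: "poly_functional s 0 = 0"
  by (simp add: poly_functional_def)

lemma poly_functional_diff:
  "poly_functional s (p - r) = poly_functional s p - poly_functional s r"
  using poly_functional_add [of s p "Polynomial.smult (-1) r"] poly_functional_smult [of s "-1" r]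
  by simp

lemma poly_functional_sum:
  "poly_functional s (\<Sum>x\<in>A. f x) = (\<Sum>x\<in>A. poly_functional s (f x))"
  by (induction A rule: infinite_finite_induct) (simp_all add: poly_functional_add)

lemma poly_functional_one: "poly_functional s 1 = s 0"
  by (simp add: poly_functional_def)

lemma poly_functional_monom: "poly_functional s (monom 1 n) = s n"
  by (simp add: poly_functional_def degree_monom_eq if_distrib [of "\<lambda>x. x * _"] cong: if_cong)

text \<open>Expand \<open>r\<close> into monomials of exponent below \<open>n\<close>. The bound on
  \<open>r\<close> is put on coefficients rather than on the degree so that \<open>n = 0\<close> is
  covered, where it forces \<open>r = 0\<close>.\<close>

lemma poly_functional_mult_eq_0:
  assumes "\<And>j. j < n \<Longrightarrow> poly_functional s (p * monom 1 j) = 0"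
    and "\<And>i. i \<ge> n \<Longrightarrow> coeff r i = 0"
  shows "poly_functional s (p * r) = 0"
proof -
  have "p * r = (\<Sum>i\<le>degree r. Polynomial.smult (coeff r i) (p * monom 1 i))"
    by (subst poly_as_sum_of_monoms [of r, symmetric])
      (simp add: sum_distrib_left smult_monom flip: mult_smult_right)
  moreover have "coeff r i * poly_functional s (p * monom 1 i) = 0" for i
    using assms by (cases "i < n") auto
  ultimately show ?thesis
    by (simp only: poly_functional_sum poly_functional_smult sum.neutral_const)
qed

section \<open>Real polynomials at complex points\<close>

lemma poly_map_poly_of_real_add:
  "poly (map_poly complex_of_real (p + r)) z
    = poly (map_poly complex_of_real p) z + poly (map_poly complex_of_real r) z"
proof -
  have "map_poly complex_of_real (p + r) = map_poly complex_of_real p + map_poly complex_of_real r"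
    by (rule poly_eqI) (simp add: coeff_map_poly)
  then show ?thesis
    by simp
qed

lemma poly_map_poly_of_real_smult:
  "poly (map_poly complex_of_real (Polynomial.smult k p)) z
    = of_real k * poly (map_poly complex_of_real p) z"
proof -
  have "map_poly complex_of_real (Polynomial.smult k p)
      = Polynomial.smult (of_real k) (map_poly complex_of_real p)"
    by (rule poly_eqI) (simp add: coeff_map_poly)
  then show ?thesis
    by simp
qed

lemma poly_map_poly_of_real_mult:
  "poly (map_poly complex_of_real (p * r)) z
    = poly (map_poly complex_of_real p) z * poly (map_poly complex_of_real r) z"
  by (induction p)
    (simp_all add: map_poly_pCons poly_map_poly_of_real_add poly_map_poly_of_real_smult algebra_simps)

lemma poly_map_poly_of_real_of_real:
  "poly (map_poly complex_of_real p) (of_real x) = of_real (poly p x)"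
  by (induction p) (simp_all add: map_poly_pCons)

lemma poly_map_poly_of_real_inject:
  assumes "\<And>z. poly (map_poly complex_of_real p) z = poly (map_poly complex_of_real r) z"
  shows "p = r"
proof (rule poly_eqI)
  have "map_poly complex_of_real p = map_poly complex_of_real r"
    using assms by (simp add: poly_eq_poly_eq_iff [symmetric] fun_eq_iff)
  from arg_cong [OF this, of "\<lambda>t. coeff t n" for n]
  show "coeff p n = coeff r n" for n
    by (simp add: coeff_map_poly)
qed

text \<open>The remainder modulo the quadratic is real of degree at most 1 and vanishes at a
  non-real point, hence is zero.\<close>

lemma quadratic_dvd_of_nonreal_root:
  assumes root: "poly (map_poly complex_of_real p) (Complex u v) = 0" and v: "v \<noteq> 0"
  shows "([:-u, 1:] * [:-u, 1:] + [:v * v:]) dvd p"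
proof -
  define d where "d = [:-u, 1:] * [:-u, 1:] + [:v * v:]"
  have d: "degree d = 2" "d \<noteq> 0"
    by (auto simp: d_def)
  define r where "r = p mod d"
  have "degree r \<le> 1"
    using degree_mod_less [of d p] d by (auto simp: r_def)
  then have "r = [:coeff r 0, coeff r 1:]"
    by (intro poly_eqI) (auto simp: coeff_pCons coeff_eq_0 split: nat.split)
  then obtain e f where r: "r = [:e, f:]" ..
  have "p = d * (p div d) + r"
    by (simp add: r_def)
  moreover have "poly (map_poly complex_of_real d) (Complex u v) = 0"
    by (simp add: d_def map_poly_pCons complex_eq_iff algebra_simps)
  ultimately have "poly (map_poly complex_of_real r) (Complex u v) = 0"
    using root poly_map_poly_of_real_add [of "d * (p div d)" r "Complex u v"]
      poly_map_poly_of_real_mult [of d "p div d" "Complex u v"] by simp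
  then have "r = 0"
    using v by (auto simp: r map_poly_pCons complex_eq_iff)
  then show ?thesis
    by (simp add: r_def d_def mod_eq_0_iff_dvd)
qed

text \<open>A factor with \<open>v = 0\<close> is a double real root, one with nonzero
  \<open>v\<close> a conjugate pair. Without them all roots are real and simple, and they can be
  split off one at a time.\<close>

lemma card_roots_eq_degree:
  assumes "P \<noteq> 0"
    and "\<And>u v :: real. \<not> ([:-u, 1:] * [:-u, 1:] + [:v * v:]) dvd P"
  shows "card {x. poly P x = 0} = degree P"
  using assms
proof (induction "degree P" arbitrary: P)
  case 0
  then obtain k where "P = [:k:]" "k \<noteq> 0"
    by (auto elim: degree_eq_zeroE)
  then show ?case
    by simp
next
  case (Suc n)
  have "degree (map_poly complex_of_real P) = degree P"
    by (simp add: degree_map_poly)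
  then have "\<not> constant (poly (map_poly complex_of_real P))"
    using Suc.hyps(2) by (simp add: constant_degree)
  then obtain w where "poly (map_poly complex_of_real P) w = 0"
    using fundamental_theorem_of_algebra by blast
  then have w: "poly (map_poly complex_of_real P) (Complex (Re w) (Im w)) = 0"
    by simp
  then have "Im w = 0"
    using quadratic_dvd_of_nonreal_root Suc.prems(2) by blast
  with w have "poly P (Re w) = 0"
    using poly_map_poly_of_real_of_real [of P "Re w"] by (simp add: complex_of_real_def zero_complex.code)
  then obtain R where R: "P = [:- Re w, 1:] * R"
    by (auto simp: poly_eq_0_iff_dvd)
  with Suc.prems have "R \<noteq> 0"
    by auto
  then have deg: "degree P = Suc (degree R)"
    by (simp add: R degree_mult_eq del: mult_pCons_left)
  have "card {x. poly R x = 0} = degree R"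
  proof (rule Suc.hyps)
    show "n = degree R" "R \<noteq> 0"
      using Suc.hyps(2) deg \<open>R \<noteq> 0\<close> by simp_all
    show "\<not> ([:-u, 1:] * [:-u, 1:] + [:v * v:]) dvd R" for u v
      using Suc.prems(2) [of u v] dvd_mult unfolding R by blast
  qed
  moreover have "poly R (Re w) \<noteq> 0"
  proof
    assume "poly R (Re w) = 0"
    then have "[:- Re w, 1:] * [:- Re w, 1:] dvd P"
      unfolding R by (intro mult_dvd_mono) (simp_all add: poly_eq_0_iff_dvd)
    with Suc.prems(2) [of "Re w" 0] show False
      by simp
  qed
  moreover have "{x. poly P x = 0} = insert (Re w) {x. poly R x = 0}"
    by (auto simp: R)
  ultimately show ?case
    using poly_roots_finite [OF \<open>R \<noteq> 0\<close>] deg by simp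
qed

locale orthogonal_polynomials =
  fixes s :: "nat \<Rightarrow> real" and p :: "nat \<Rightarrow> real poly"
  assumes degree_p: "degree (p n) = n"
    and monic_p: "lead_coeff (p n) = 1"
    and orthogonal: "j < n \<Longrightarrow> poly_functional s (p n * monom 1 j) = 0"
    and square_pos: "0 < poly_functional s (p n * p n)"
begin

lemma orthogonal_lower_degree: "degree r < n \<Longrightarrow> poly_functional s (p n * r) = 0"
  by (rule poly_functional_mult_eq_0 [where n = n]) (auto intro: orthogonal coeff_eq_0)

text \<open>Write \<open>r\<close> as \<open>k\<close> times \<open>p n\<close> plus a remainder
  \<open>t\<close> of lower degree. Orthogonality removes the cross terms, and the square of
  \<open>t\<close> is handled by induction.\<close>

lemma positive_definite:
  assumes "r \<noteq> 0"
  shows "0 < poly_functional s (r * r)"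
  using assms
proof (induction "degree r" arbitrary: r rule: less_induct)
  case less
  define n k where "n = degree r" and "k = lead_coeff r"
  define t where "t = r - Polynomial.smult k (p n)"
  have k: "k \<noteq> 0"
    using less.prems by (simp add: k_def)
  have r: "r = Polynomial.smult k (p n) + t"
    by (simp add: t_def)
  have ct: "coeff t i = 0" if "i \<ge> n" for i
    using that degree_p [of n] monic_p [of n]
    by (cases "i = n") (auto simp: t_def n_def k_def coeff_eq_0)
  have "r * r = Polynomial.smult k (Polynomial.smult k (p n * p n)) + Polynomial.smult k (p n * t)
      + Polynomial.smult k (p n * t) + t * t"
    by (simp add: r algebra_simps flip: mult_2)
  moreover have "poly_functional s (p n * t) = 0"
    by (rule poly_functional_mult_eq_0 [where n = n]) (auto intro: orthogonal ct)
  ultimately have "poly_functional s (r * r) = k * k * poly_functional s (p n * p n) + poly_functional s (t * t)"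
    by (simp only: poly_functional_add poly_functional_smult)
  moreover have "0 \<le> poly_functional s (t * t)"
  proof (cases "t = 0")
    case False
    then have "degree t < n"
      using ct leading_coeff_neq_0 not_le by blast
    with False less.hyps [of t] show ?thesis
      by (simp add: n_def less_imp_le)
  qed simp
  ultimately show ?case
    using mult_pos_pos [OF _ square_pos [of n], of "k * k"] k
    by (metis add_pos_nonneg not_real_square_gt_zero)
qed

lemma p_nonzero: "p n \<noteq> 0"
  using monic_p [of n] by auto

text \<open>If a double real root or a pair of complex conjugate roots were split off \<^term>\<open>p n\<close>,
  the product of \<^term>\<open>p n\<close> with the cofactor would have positive value.\<close>

lemma not_quadratic_factor: "p n \<noteq> ([:-u, 1:] * [:-u, 1:] + [:v * v:]) * r"
proof
  assume eq: "p n = ([:-u, 1:] * [:-u, 1:] + [:v * v:]) * r"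
  with p_nonzero have r: "r \<noteq> 0"
    by force
  have "degree ([:-u, 1:] * [:-u, 1:] + [:v * v:]) = 2"
    by simp
  with eq r have "n = 2 + degree r"
    using degree_p [of n] degree_mult_eq [of "[:-u, 1:] * [:-u, 1:] + [:v * v:]" r] by force
  then have "poly_functional s (p n * r) = 0"
    by (intro orthogonal_lower_degree) simp
  moreover have "p n * r = ([:-u, 1:] * r) * ([:-u, 1:] * r) + [:v * v:] * (r * r)"
    by (simp only: eq ring_distribs ac_simps)
  then have "p n * r = ([:-u, 1:] * r) * ([:-u, 1:] * r) + Polynomial.smult (v * v) (r * r)"
    by simp
  moreover have "0 < poly_functional s (([:-u, 1:] * r) * ([:-u, 1:] * r))"
    using r by (intro positive_definite) (simp del: mult_pCons_left)
  moreover have "0 \<le> v * v * poly_functional s (r * r)"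
    using positive_definite [OF r] by simp
  ultimately show False
    by (simp only: poly_functional_add poly_functional_smult)
qed

lemma card_roots_p: "card {x. poly (p n) x = 0} = n"
  using card_roots_eq_degree [OF p_nonzero [of n]] not_quadratic_factor [of n] degree_p [of n]
  by (metis dvdE)

lemma finite_roots_p: "finite {x. poly (p n) x = 0}"
  by (rule poly_roots_finite) (rule p_nonzero)

end

text \<open>\<open>ell x\<close> is the Lagrange basis polynomial at the node \<open>x\<close>. The
  two sides of the expansion agree on \<open>X\<close> and have degree below
  \<open>card X\<close>.\<close>

lemma lagrange_interpolation:
  fixes X :: "real set" and r :: "real poly"
  assumes "finite X" "degree r < card X"
  defines "ell x \<equiv> Polynomial.smult (1 / (\<Prod>y\<in>X - {x}. x - y)) (\<Prod>y\<in>X - {x}. [:-y, 1:])"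
  shows "r = (\<Sum>x\<in>X. Polynomial.smult (poly r x) (ell x))"
    and "x \<in> X \<Longrightarrow> degree (ell x) < card X"
    and "x \<in> X \<Longrightarrow> y \<in> X \<Longrightarrow> poly (ell x) y = (if x = y then 1 else 0)"
proof -
  show deg: "degree (ell x) < card X" if "x \<in> X" for x
  proof -
    have "degree (\<Prod>y\<in>X - {x}. [:-y, 1:]) \<le> card (X - {x})"
      using degree_prod_sum_le [of "X - {x}" "\<lambda>y. [:-y, 1:]"] assms(1) by simp
    also have "\<dots> < card X"
      using assms(1) that by (rule card_Diff1_less)
    finally show ?thesis
      unfolding ell_def using degree_smult_le le_less_trans by blast
  qed
  show val: "poly (ell x) y = (if x = y then 1 else 0)" if "x \<in> X" "y \<in> X" for x y
    using that assms(1) by (auto simp: ell_def poly_prod)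
  show "r = (\<Sum>x\<in>X. Polynomial.smult (poly r x) (ell x))"
  proof (rule poly_eqI_degree)
    show "poly r y = poly (\<Sum>x\<in>X. Polynomial.smult (poly r x) (ell x)) y" if "y \<in> X" for y
      using that assms(1) by (simp add: poly_sum val if_distrib [of "\<lambda>t. _ * t"] cong: if_cong)
    have "0 < card X"
      using assms(2) by simp
    moreover have "degree (\<Sum>x\<in>X. Polynomial.smult (poly r x) (ell x)) \<le> card X - 1"
      using deg assms(1) \<open>0 < card X\<close>
      by (intro degree_sum_le order_trans [OF degree_smult_le]) (auto simp: Suc_le_eq le_diff_conv2)
    ultimately show "degree (\<Sum>x\<in>X. Polynomial.smult (poly r x) (ell x)) < card X"
      by linarith
  qed (use assms(2) in simp)
qed

context orthogonal_polynomials
begin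

text \<open>The nodes are the zeros of \<open>p n\<close> and the weights are the values of the
  functional on the Lagrange basis. Divide \<open>r\<close> by \<open>p n\<close>: the quotient has
  degree below \<open>n\<close> and contributes nothing by orthogonality, and the remainder is
  interpolated exactly.\<close>

lemma gauss_quadrature:
  assumes "0 < n"
  shows "\<exists>w. (\<forall>x. poly (p n) x = 0 \<longrightarrow> 0 \<le> w x) \<and> (\<forall>r. degree r < 2 * n \<longrightarrow>
    poly_functional s r = (\<Sum>x | poly (p n) x = 0. w x * poly r x))"
proof -
  define X where "X = {x. poly (p n) x = 0}"
  have X: "finite X" "card X = n"
    by (simp_all add: X_def finite_roots_p card_roots_p)
  define ell where
    "ell x = Polynomial.smult (1 / (\<Prod>y\<in>X - {x}. x - y)) (\<Prod>y\<in>X - {x}. [:-y, 1:])" for x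
  have ell_degree: "degree (ell x) < n" if "x \<in> X" for x
    using lagrange_interpolation(2) [OF X(1), of 0 x] X(2) assms that by (simp add: ell_def)
  have ell_value: "poly (ell x) y = (if x = y then 1 else 0)" if "x \<in> X" "y \<in> X" for x y
    using lagrange_interpolation(3) [OF X(1), of 0 x y] X(2) assms that by (simp add: ell_def)
  have quadrature: "poly_functional s r = (\<Sum>x\<in>X. poly_functional s (ell x) * poly r x)"
    if "degree r < 2 * n" for r
  proof -
    define g t where "g = r div p n" and "t = r mod p n"
    have r: "r = p n * g + t"
      by (simp add: g_def t_def)
    have "degree t < n"
      using degree_mod_less' [of "p n" r] p_nonzero [of n] degree_p [of n] assms
      by (cases "t = 0") (auto simp: t_def)
    then have t: "t = (\<Sum>x\<in>X. Polynomial.smult (poly t x) (ell x))"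
      unfolding ell_def using lagrange_interpolation(1) [OF X(1)] X(2) by simp
    have "degree g < n"
    proof (cases "g = 0")
      case False
      then have "degree (p n * g) = n + degree g"
        by (simp add: degree_mult_eq p_nonzero degree_p)
      then have "degree r = n + degree g"
        using \<open>degree t < n\<close> by (simp add: r degree_add_eq_left)
      with that show ?thesis
        by simp
    qed (use assms in simp)
    then have "poly_functional s r = poly_functional s t"
      by (simp add: r poly_functional_add orthogonal_lower_degree)
    also have "\<dots> = (\<Sum>x\<in>X. poly t x * poly_functional s (ell x))"
      by (subst t) (simp add: poly_functional_sum poly_functional_smult)
    also have "\<dots> = (\<Sum>x\<in>X. poly_functional s (ell x) * poly r x)"
      by (rule sum.cong) (auto simp: r X_def)
    finally show ?thesis .
  qed
  \<comment> \<open>Exactness up to degree \<open>2 * n - 1\<close> covers the square of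
    \<open>ell x\<close>, which is 1 at \<open>x\<close> and 0 at the other nodes; so the weight is
    a value on a square.\<close>
  have weight: "0 \<le> poly_functional s (ell x)" if "x \<in> X" for x
  proof -
    have "ell x \<noteq> 0"
      using ell_value [OF that that] by auto
    then have "0 < poly_functional s (ell x * ell x)"
      by (rule positive_definite)
    also have "poly_functional s (ell x * ell x)
        = (\<Sum>y\<in>X. poly_functional s (ell y) * poly (ell x * ell x) y)"
      using degree_mult_le [of "ell x" "ell x"] ell_degree [OF that] by (intro quadrature) linarith
    also have "\<dots> = (\<Sum>y\<in>X. if y = x then poly_functional s (ell x) else 0)"
      using that by (intro sum.cong) (auto simp: ell_value)
    also have "\<dots> = poly_functional s (ell x)"
      using X(1) that by simp
    finally show ?thesis
      by simp
  qed
  show ?thesis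
    by (rule exI [of _ "\<lambda>x. poly_functional s (ell x)"]) (use weight quadrature in \<open>simp add: X_def\<close>)
qed

end

section \<open>The representing measure\<close>

text \<open>The clamp only matters where \<open>\<bar>x\<bar> > R\<close>. There the difference is
  at most twice \<open>\<bar>x\<bar> ^ j\<close>, and multiplying by \<open>R\<close> costs at most
  one further factor \<open>\<bar>x\<bar>\<close>. The even exponent makes the bound a polynomial,
  so that it integrates to a moment.\<close>

lemma abs_power_diff_clamp_le:
  fixes x R :: real
  assumes "1 \<le> R"
  shows "\<bar>x ^ j - max (- R) (min R x) ^ j\<bar> \<le> 2 * x ^ (2 * j + 2) / R"
proof (cases "\<bar>x\<bar> \<le> R")
  case True
  then have "max (- R) (min R x) = x"
    by linarith
  moreover have "0 \<le> x ^ (2 * j + 2)"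
    by (intro zero_le_even_power) simp
  ultimately show ?thesis
    using assms by (simp only: diff_self abs_zero) simp
next
  case False
  then have x: "R < \<bar>x\<bar>" "1 \<le> \<bar>x\<bar>"
    using assms by linarith+
  have "\<bar>max (- R) (min R x)\<bar> \<le> \<bar>x\<bar>"
    using assms x by linarith
  then have "\<bar>max (- R) (min R x)\<bar> ^ j \<le> \<bar>x\<bar> ^ j"
    by (intro power_mono) auto
  then have "\<bar>x ^ j - max (- R) (min R x) ^ j\<bar> \<le> 2 * \<bar>x\<bar> ^ j"
    using abs_triangle_ineq4 [of "x ^ j" "max (- R) (min R x) ^ j"] unfolding power_abs by linarith
  then have "\<bar>x ^ j - max (- R) (min R x) ^ j\<bar> * R \<le> 2 * \<bar>x\<bar> ^ j * \<bar>x\<bar>"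
    using x assms by (intro mult_mono) auto
  also have "\<dots> = 2 * \<bar>x\<bar> ^ (j + 1)"
    by simp
  also have "\<dots> \<le> 2 * \<bar>x\<bar> ^ (2 * j + 2)"
    using x by (intro mult_left_mono power_increasing) auto
  also have "\<bar>x\<bar> ^ (2 * j + 2) = x ^ (2 * j + 2)"
    by (intro power_even_abs) simp
  finally show ?thesis
    using assms by (simp only: le_divide_eq) simp
qed

text \<open>The truncation error is controlled by a single higher moment, hence uniformly over all
  measures that share it.\<close>

lemma (in real_distribution) abs_moment_diff_clamp_le:
  fixes R :: real
  assumes int: "\<And>i. integrable M (\<lambda>x. x ^ i)" and R: "1 \<le> R"
  shows "\<bar>(\<integral>x. x ^ j \<partial>M) - (\<integral>x. max (- R) (min R x) ^ j \<partial>M)\<bar> \<le> 2 * (\<integral>x. x ^ (2 * j + 2) \<partial>M) / R"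
proof -
  have [simp]: "integrable M (\<lambda>x. max (- R) (min R x) ^ j)"
  proof (rule integrable_const_bound [where B = "R ^ j"])
    show "AE x in M. norm (max (- R) (min R x) ^ j) \<le> R ^ j"
      using R by (auto simp: power_abs intro!: AE_I2 power_mono)
  qed simp
  have "\<bar>(\<integral>x. x ^ j \<partial>M) - (\<integral>x. max (- R) (min R x) ^ j \<partial>M)\<bar>
      = \<bar>\<integral>x. x ^ j - max (- R) (min R x) ^ j \<partial>M\<bar>"
    by (simp add: int)
  also have "\<dots> \<le> (\<integral>x. \<bar>x ^ j - max (- R) (min R x) ^ j\<bar> \<partial>M)"
    by (rule integral_abs_bound)
  also have "\<dots> \<le> (\<integral>x. 2 * x ^ (2 * j + 2) / R \<partial>M)"
    by (intro integral_mono integrable_abs Bochner_Integration.integrable_diff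
        Bochner_Integration.integrable_divide integrable_mult_right int abs_power_diff_clamp_le R) simp
  finally show ?thesis
    by simp
qed

text \<open>Chebyshev's inequality bounds the mass outside \<open>{- R<..R}\<close> by
  \<open>K / R ^ 2\<close>.\<close>

lemma tight_of_second_moment:
  fixes \<nu> :: "nat \<Rightarrow> real measure"
  assumes dist: "\<And>n. real_distribution (\<nu> n)"
    and int: "\<And>n. integrable (\<nu> n) (\<lambda>x. x ^ 2)"
    and bound: "\<And>n. (\<integral>x. x ^ 2 \<partial>\<nu> n) \<le> K"
  shows "tight \<nu>"
  unfolding tight_def
proof (intro conjI allI impI)
  fix \<epsilon> :: real
  assume \<epsilon>: "0 < \<epsilon>"
  \<comment> \<open>This gives \<open>K < \<epsilon> * R\<close>, and \<open>1 \<le> R\<close> lets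
    \<open>R\<close> be replaced by its square.\<close>
  define R where "R = \<bar>K\<bar> / \<epsilon> + 1"
  have R: "1 \<le> R" "\<bar>K\<bar> / \<epsilon> < R"
    using \<epsilon> by (auto simp: R_def)
  then have "K < \<epsilon> * R"
    using \<epsilon> by (simp add: divide_less_eq mult.commute)
  also have "\<dots> \<le> \<epsilon> * R ^ 2"
    using R \<epsilon> by (intro mult_left_mono) (auto simp: power2_eq_square)
  finally have K: "K / R ^ 2 < \<epsilon>"
    using R by (simp add: divide_less_eq)
  show "\<exists>c d. c < d \<and> (\<forall>n. 1 - \<epsilon> < measure (\<nu> n) {c<..d})"
  proof (intro exI conjI allI)
    show "- R < R"
      using R by simp
    fix n
    interpret real_distribution "\<nu> n"
      by (rule dist)
    have "1 - measure (\<nu> n) {- R<..R} = (\<integral>x. 1 - indicator {- R<..R} x \<partial>\<nu> n)"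
      using prob_space by (subst Bochner_Integration.integral_diff) (auto intro: integrable_const_bound [where B = 1])
    also have "\<dots> \<le> (\<integral>x. x ^ 2 / R ^ 2 \<partial>\<nu> n)"
    proof (rule integral_mono)
      show "integrable (\<nu> n) (\<lambda>x. 1 - indicator {- R<..R} x :: real)"
        by (intro Bochner_Integration.integrable_diff integrable_const_bound [where B = 1]) auto
      show "integrable (\<nu> n) (\<lambda>x. x ^ 2 / R ^ 2)"
        using int by simp
      fix x :: real
      show "1 - indicator {- R<..R} x \<le> x ^ 2 / R ^ 2"
      proof (cases "x \<in> {- R<..R}")
        case False
        then have "R ^ 2 \<le> \<bar>x\<bar> ^ 2"
          using R by (intro power_mono) auto
        then show ?thesis
          using R False by (simp add: le_divide_eq)
      qed simp
    qed
    also have "\<dots> \<le> K / R ^ 2"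
      using bound R by (simp add: divide_right_mono)
    finally show "1 - \<epsilon> < measure (\<nu> n) {- R<..R}"
      using K by linarith
  qed
qed (rule dist)

text \<open>Helly selection yields a weak limit, which only tests bounded continuous functions, so
  powers are clamped and the error is sent to 0. The range \<open>j \<le> n + 2\<close> gives every
  measure of the sequence the second moment \<open>s 2\<close>, hence tightness, and makes each
  moment eventually equal to \<open>s j\<close>.\<close>

theorem moment_sequence_limit:
  fixes \<nu> :: "nat \<Rightarrow> real measure"
  assumes dist: "\<And>n. real_distribution (\<nu> n)"
    and int: "\<And>n j. integrable (\<nu> n) (\<lambda>x. x ^ j)"
    and moments: "\<And>n j. j \<le> n + 2 \<Longrightarrow> (\<integral>x. x ^ j \<partial>\<nu> n) = s j"
  shows "\<exists>\<mu>. real_distribution \<mu> \<and> (\<forall>j. integrable \<mu> (\<lambda>x. x ^ j) \<and> (\<integral>x. x ^ j \<partial>\<mu>) = s j)"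
proof -
  have "tight \<nu>"
    using dist int by (rule tight_of_second_moment [where K = "s 2"]) (simp add: moments)
  then obtain r \<mu> where r: "strict_mono r" and \<mu>: "real_distribution \<mu>"
    and conv: "weak_conv_m (\<nu> \<circ> id \<circ> r) \<mu>"
    using tight_imp_convergent_subsubsequence [of \<nu> id] strict_mono_id by blast
  interpret \<mu>: real_distribution \<mu>
    by (rule \<mu>)
  have integral_conv: "(\<lambda>n. \<integral>x. f x \<partial>\<nu> (r n)) \<longlonglongrightarrow> (\<integral>x. f x \<partial>\<mu>)"
    if "\<And>x. isCont f x" "\<And>x. norm (f x) \<le> B" for f :: "real \<Rightarrow> real" and B
    using weak_conv_imp_integral_bdd_continuous_conv [OF _ \<mu> conv that] dist by simp
  have moments': "eventually (\<lambda>n. (\<integral>x. x ^ j \<partial>\<nu> (r n)) = s j) sequentially" for j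
  proof (rule eventually_sequentiallyI)
    fix n
    assume "j \<le> n"
    then show "(\<integral>x. x ^ j \<partial>\<nu> (r n)) = s j"
      using strict_mono_imp_increasing [OF r, of n] by (intro moments) linarith
  qed
  \<comment> \<open>The radius \<open>Suc i\<close> is at least 1, as the truncation estimate
    requires.\<close>
  define clamp :: "nat \<Rightarrow> real \<Rightarrow> real" where "clamp i x = max (- real (Suc i)) (min (real (Suc i)) x)" for i x
  have clamp_bound: "norm (clamp i x ^ j) \<le> real (Suc i) ^ j" for i j x
    unfolding norm_power by (rule power_mono) (auto simp: clamp_def)
  have clamp_cont: "isCont (\<lambda>x. clamp i x ^ j) x" for i j x
    unfolding clamp_def by (intro continuous_intros)
  have clamp_meas [measurable]: "clamp i \<in> borel_measurable borel" for i
    unfolding clamp_def by simp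
  have clamp_le: "\<bar>clamp i x\<bar> \<le> \<bar>x\<bar>" for i x
    by (auto simp: clamp_def)
  have clamp_conv: "(\<lambda>n. \<integral>x. clamp i x ^ j \<partial>\<nu> (r n)) \<longlonglongrightarrow> (\<integral>x. clamp i x ^ j \<partial>\<mu>)" for i j
    by (rule integral_conv clamp_cont clamp_bound)+
  have clamp_int: "integrable N (\<lambda>x. clamp i x ^ j)" if "real_distribution N" for N i j
  proof -
    interpret real_distribution N
      by (rule that)
    show ?thesis
      by (rule integrable_const_bound [where B = "real (Suc i) ^ j"]) (use clamp_bound in auto)
  qed
  have even_bound: "(\<integral>x. clamp i x ^ (2 * k) \<partial>\<mu>) \<le> s (2 * k)" for i k
  proof (rule tendsto_upperbound [OF clamp_conv])
    have "(\<integral>x. clamp i x ^ (2 * k) \<partial>\<nu> n) \<le> (\<integral>x. x ^ (2 * k) \<partial>\<nu> n)" for n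
      using clamp_int [OF dist] int
    proof (rule integral_mono)
      show "clamp i x ^ (2 * k) \<le> x ^ (2 * k)" for x
        using power_mono [OF clamp_le [of i x], of "2 * k"] by (simp add: power_even_abs)
    qed
    then show "\<forall>\<^sub>F n in sequentially. (\<integral>x. clamp i x ^ (2 * k) \<partial>\<nu> (r n)) \<le> s (2 * k)"
      using moments' [of "2 * k"] by (auto elim!: eventually_mono) metis
  qed simp
  \<comment> \<open>Even powers come first because they are nonnegative: Fatou's lemma applies as
    the clamp radius grows, with \<open>even_bound\<close> bounding the clamped integrals.\<close>
  have even_int: "integrable \<mu> (\<lambda>x. x ^ (2 * k))" for k
  proof (rule integrableI_nonneg)
    have "(\<integral>\<^sup>+x. ennreal (x ^ (2 * k)) \<partial>\<mu>) = (\<integral>\<^sup>+x. liminf (\<lambda>i. ennreal (clamp i x ^ (2 * k))) \<partial>\<mu>)"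
    proof (rule nn_integral_cong)
      fix x :: real
      obtain N :: nat where N: "\<bar>x\<bar> \<le> real N"
        using real_arch_simple by blast
      have "clamp i x = x" if "N \<le> i" for i
        using N that by (auto simp: clamp_def)
      then have "(\<lambda>i. ennreal (clamp i x ^ (2 * k))) \<longlonglongrightarrow> ennreal (x ^ (2 * k))"
        by (intro tendsto_eventually eventually_sequentiallyI [of N]) simp
      then show "ennreal (x ^ (2 * k)) = liminf (\<lambda>i. ennreal (clamp i x ^ (2 * k)))"
        by (intro lim_imp_Liminf [symmetric]) auto
    qed
    also have "\<dots> \<le> liminf (\<lambda>i. \<integral>\<^sup>+x. ennreal (clamp i x ^ (2 * k)) \<partial>\<mu>)"
      by (rule nn_integral_liminf) simp
    also have "\<dots> \<le> liminf (\<lambda>i::nat. ennreal (s (2 * k)))"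
    proof (intro Liminf_mono always_eventually allI)
      fix i
      show "(\<integral>\<^sup>+x. ennreal (clamp i x ^ (2 * k)) \<partial>\<mu>) \<le> ennreal (s (2 * k))"
        using even_bound [of i k] by (subst nn_integral_eq_integral) (auto intro: clamp_int [OF \<mu>] ennreal_leI)
    qed
    also have "\<dots> < \<infinity>"
      by (simp add: Liminf_const)
    finally show "(\<integral>\<^sup>+x. ennreal (x ^ (2 * k)) \<partial>\<mu>) < \<infinity>" .
  qed auto
  have int_\<mu>: "integrable \<mu> (\<lambda>x. x ^ j)" for j
  proof (rule Bochner_Integration.integrable_bound)
    show "integrable \<mu> (\<lambda>x. 1 + x ^ (2 * j))"
      using even_int by simp
    \<comment> \<open>This follows from \<open>(\<bar>y\<bar> - 1) ^ 2 \<ge> 0\<close> with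
      \<open>y = x ^ j\<close>.\<close>
    have "\<bar>x ^ j\<bar> \<le> 1 + x ^ (2 * j)" for x :: real
      using zero_le_power2 [of "\<bar>x ^ j\<bar> - 1"] zero_le_power2 [of "x ^ j"]
      unfolding power_even_eq power2_diff power2_abs one_power2 mult_1_right by linarith
    then show "AE x in \<mu>. norm (x ^ j) \<le> norm (1 + x ^ (2 * j))"
      unfolding real_norm_def by (intro AE_I2 order_trans [OF _ abs_ge_self])
  qed simp
  have "(\<integral>x. x ^ j \<partial>\<mu>) = s j" for j
  proof -
    \<comment> \<open>The two summands are the truncation errors for the approximating measures,
      whose moment of order \<open>2 * j + 2\<close> is eventually \<open>s (2 * j + 2)\<close>, and
      for the limit.\<close>
    define K where "K = 2 * s (2 * j + 2) + 2 * (\<integral>x. x ^ (2 * j + 2) \<partial>\<mu>)"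
    have "\<bar>(\<integral>x. x ^ j \<partial>\<mu>) - s j\<bar> \<le> K / real (Suc i)" for i
    proof -
      have "\<bar>(\<integral>x. clamp i x ^ j \<partial>\<mu>) - s j\<bar> \<le> 2 * s (2 * j + 2) / real (Suc i)"
      proof (rule tendsto_upperbound)
        show "(\<lambda>n. \<bar>(\<integral>x. clamp i x ^ j \<partial>\<nu> (r n)) - s j\<bar>) \<longlonglongrightarrow> \<bar>(\<integral>x. clamp i x ^ j \<partial>\<mu>) - s j\<bar>"
          by (intro tendsto_intros clamp_conv)
        show "\<forall>\<^sub>F n in sequentially. \<bar>(\<integral>x. clamp i x ^ j \<partial>\<nu> (r n)) - s j\<bar> \<le> 2 * s (2 * j + 2) / real (Suc i)"
          using moments' [of j] moments' [of "2 * j + 2"]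
        proof eventually_elim
          case (elim n)
          then show ?case
            using real_distribution.abs_moment_diff_clamp_le [OF dist int, of "real (Suc i)" "r n" j]
            unfolding clamp_def by (simp only:) (simp add: abs_minus_commute)
        qed
      qed simp
      moreover have "\<bar>(\<integral>x. x ^ j \<partial>\<mu>) - (\<integral>x. clamp i x ^ j \<partial>\<mu>)\<bar>
          \<le> 2 * (\<integral>x. x ^ (2 * j + 2) \<partial>\<mu>) / real (Suc i)"
        unfolding clamp_def by (rule \<mu>.abs_moment_diff_clamp_le) (auto intro: int_\<mu>)
      ultimately show ?thesis
        unfolding K_def add_divide_distrib by linarith
    qed
    moreover have "(\<lambda>i. K / real (Suc i)) \<longlonglongrightarrow> 0"
      by (intro LIMSEQ_Suc lim_const_over_n)
    ultimately have "\<bar>(\<integral>x. x ^ j \<partial>\<mu>) - s j\<bar> \<le> 0"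
      by (intro tendsto_lowerbound [where F = sequentially]) (auto intro: always_eventually)
    then show ?thesis
      by simp
  qed
  with \<mu> int_\<mu> show ?thesis
    by blast
qed

section \<open>Quadrature rules as probability measures\<close>

lemma finitely_supported_distribution:
  fixes w :: "real \<Rightarrow> real"
  assumes X: "finite X" and w: "\<And>x. x \<in> X \<Longrightarrow> 0 \<le> w x" "(\<Sum>x\<in>X. w x) = 1"
  shows "\<exists>\<nu>. real_distribution \<nu> \<and> (\<forall>f \<in> borel_measurable borel.
    integrable \<nu> f \<and> (\<integral>x. f x \<partial>\<nu>) = (\<Sum>x\<in>X. w x * f x :: real))"
proof -
  \<comment> \<open>The sigma-algebra of \<open>N\<close> is the power set of \<open>X\<close>;
    pushing \<open>N\<close> forward along the inclusion gives a measure on the Borel sets of the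
    line.\<close>
  define N where "N = point_measure X (\<lambda>x. ennreal (w x))"
  have id: "(\<lambda>x. x) \<in> measurable N borel"
    by (simp add: N_def)
  have "emeasure N (space N) = 1"
    using X w by (simp add: N_def space_point_measure emeasure_point_measure_finite sum_ennreal)
  then have "prob_space N"
    by (rule prob_spaceI)
  then have "real_distribution (distr N borel (\<lambda>x. x))"
    using id by (simp add: real_distribution_def real_distribution_axioms_def prob_space.prob_space_distr)
  moreover have "integrable (distr N borel (\<lambda>x. x)) f \<and> (\<integral>x. f x \<partial>distr N borel (\<lambda>x. x)) = (\<Sum>x\<in>X. w x * f x)"
    if "f \<in> borel_measurable borel" for f :: "real \<Rightarrow> real"
    unfolding integrable_distr_eq [OF id that] integral_distr [OF id that] unfolding N_def
    using integrable_point_measure_finite [OF X, of w f] lebesgue_integral_point_measure_finite [of X w f] X w(1)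
    by simp
  ultimately show ?thesis
    by blast
qed

text \<open>The quadrature with \<open>n + 2\<close> nodes is exact below degree
  \<open>2 * (n + 2)\<close>, so it has the prescribed moments up to \<open>n + 2\<close>. Since
  \<open>s 0 = 1\<close>, the weights sum to 1.\<close>

theorem (in orthogonal_polynomials) exists_representing_measure:
  assumes "s 0 = 1"
  shows "\<exists>\<mu>. finite_moments_measure \<mu> \<and> moment \<mu> = s"
proof -
  have "\<exists>\<nu>. real_distribution \<nu> \<and> (\<forall>j. integrable \<nu> (\<lambda>x. x ^ j)) \<and>
      (\<forall>j\<le>n + 2. (\<integral>x. x ^ j \<partial>\<nu>) = s j)" for n
  proof -
    define X where "X = {x. poly (p (n + 2)) x = 0}"
    obtain w where w: "\<And>x. x \<in> X \<Longrightarrow> 0 \<le> w x"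
      and quad: "\<And>r. degree r < 2 * (n + 2) \<Longrightarrow> poly_functional s r = (\<Sum>x\<in>X. w x * poly r x)"
      using gauss_quadrature [of "n + 2"] by (auto simp: X_def)
    have "(\<Sum>x\<in>X. w x) = 1"
      using quad [of 1] assms by (simp add: poly_functional_one)
    moreover have "finite X"
      by (simp add: X_def finite_roots_p del: add_2_eq_Suc')
    ultimately obtain \<nu> where \<nu>: "real_distribution \<nu>"
      "\<forall>f \<in> borel_measurable borel. integrable \<nu> f \<and> (\<integral>x. f x \<partial>\<nu>) = (\<Sum>x\<in>X. w x * f x)"
      using finitely_supported_distribution [of X w] w by blast
    have integrable: "integrable \<nu> (\<lambda>x. x ^ j)"
      and integral: "(\<integral>x. x ^ j \<partial>\<nu>) = (\<Sum>x\<in>X. w x * x ^ j)" for j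
      using bspec [OF \<nu>(2), of "\<lambda>x. x ^ j"] by auto
    have "(\<integral>x. x ^ j \<partial>\<nu>) = s j" if "j \<le> n + 2" for j
      using quad [of "monom 1 j"] that
      by (simp add: integral degree_monom_eq poly_functional_monom poly_monom)
    with \<nu>(1) integrable show ?thesis
      by blast
  qed
  then obtain \<nu> where "\<And>n. real_distribution (\<nu> n)" "\<And>n j. integrable (\<nu> n) (\<lambda>x. x ^ j)"
    "\<And>n j. j \<le> n + 2 \<Longrightarrow> (\<integral>x. x ^ j \<partial>\<nu> n) = s j"
    by metis
  then obtain \<mu>
    where "real_distribution \<mu>" "\<And>j. integrable \<mu> (\<lambda>x. x ^ j)" "\<And>j. (\<integral>x. x ^ j \<partial>\<mu>) = s j"
    using moment_sequence_limit [of \<nu> s] by blast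
  then show ?thesis
    by (intro exI [of _ \<mu>])
      (auto simp: finite_moments_measure_def moment_def fun_eq_iff real_distribution.events_eq_borel)
qed

section \<open>Favard's theorem\<close>

lemma monic_degree_recurrence:
  fixes p :: "nat \<Rightarrow> real poly"
  assumes p0: "p 0 = 1"
    and rec: "\<And>n. [:0, 1:] * p n = p (n + 1) + Polynomial.smult (\<alpha> n) (p n) + Polynomial.smult (\<gamma> n) (p (n - 1))"
  shows "degree (p n) = n \<and> coeff (p n) n = 1"
proof (induction n rule: less_induct)
  case (less n)
  show ?case
  proof (cases n)
    case 0
    then show ?thesis
      by (simp add: p0)
  next
    case (Suc k)
    define t where "t = Polynomial.smult (- \<alpha> k) (p k) + Polynomial.smult (- \<gamma> k) (p (k - 1))"
    have p: "degree (p k) = k" "coeff (p k) k = 1" "degree (p (k - 1)) = k - 1"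
      using less.IH Suc by simp_all
    have t: "coeff t i = 0" if "i > k" for i
      using that p by (simp add: t_def coeff_eq_0)
    have eq: "p n = [:0, 1:] * p k + t"
      using rec [of k] Suc by (simp add: t_def algebra_simps)
    have "coeff (p n) n = 1"
      unfolding eq unfolding Suc using p t by simp
    moreover have "degree (p n) \<le> n"
      unfolding eq unfolding Suc using p t by (intro degree_le) (auto simp: coeff_pCons coeff_eq_0 split: nat.split)
    ultimately show ?thesis
      by (metis le_antisym le_degree zero_neq_one)
  qed
qed

text \<open>The functional with these moments is 1 on the constant 1 and 0 on every
  \<open>p n\<close> with \<open>n > 0\<close>, provided each \<open>p n\<close> is monic of degree
  \<open>n\<close>: the latter condition is then solved for the moment of order
  \<open>n\<close>.\<close>

fun dual_moments :: "(nat \<Rightarrow> real poly) \<Rightarrow> nat \<Rightarrow> real" where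
  "dual_moments p n = (if n = 0 then 1 else - (\<Sum>i<n. coeff (p n) i * dual_moments p i))"

declare dual_moments.simps [simp del]

text \<open>The recurrence trades a factor \<open>x\<close> of the monomial for a shift of the index
  of \<open>p\<close>, so orthogonality follows by induction on the exponent from the case of
  exponent 0. At \<open>n = 0\<close> truncated subtraction turns the last term of the recurrence
  into a multiple of \<open>p 0\<close>, which only changes the diagonal coefficient.\<close>

theorem favard:
  fixes p :: "nat \<Rightarrow> real poly"
  assumes p0: "p 0 = 1"
    and rec: "\<And>n. [:0, 1:] * p n = p (n + 1) + Polynomial.smult (\<alpha> n) (p n) + Polynomial.smult (\<gamma> n) (p (n - 1))"
    and \<gamma>: "\<And>n. 0 < n \<Longrightarrow> 0 < \<gamma> n"
  shows "\<exists>\<mu>. finite_moments_measure \<mu> \<and> moment \<mu> 0 = 1 \<and>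
    (\<forall>n j. j < n \<longrightarrow> poly_functional (moment \<mu>) (p n * monom 1 j) = 0)"
proof -
  define s where "s = dual_moments p"
  have s0: "s 0 = 1"
    by (simp add: s_def dual_moments.simps)
  have monic: "degree (p n) = n" "coeff (p n) n = 1" for n
    using monic_degree_recurrence [OF p0 rec] by auto
  have annihilated: "poly_functional s (p n) = 0" if "0 < n" for n
    using that monic [of n] dual_moments.simps [of p n]
    by (subst poly_functional_eq_sum_degree [of _ n]) (simp_all add: s_def)
  have shift: "poly_functional s (p n * monom 1 (Suc j))
      = poly_functional s (p (n + 1) * monom 1 j) + \<alpha> n * poly_functional s (p n * monom 1 j)
        + \<gamma> n * poly_functional s (p (n - 1) * monom 1 j)" for n j
  proof -
    have "p n * monom 1 (Suc j) = ([:0, 1:] * p n) * monom 1 j"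
      by (simp add: monom_Suc)
    then show ?thesis
      by (simp only: rec distrib_right poly_functional_add mult_smult_left poly_functional_smult)
  qed
  have orth: "poly_functional s (p n * monom 1 j) = 0" if "j < n" for n j
    using that
  proof (induction j arbitrary: n)
    case 0
    then show ?case
      by (simp add: annihilated monom_0)
  next
    case (Suc j)
    then have "j < n + 1" "j < n" "j < n - 1"
      by linarith+
    then show ?case
      by (simp only: shift Suc.IH mult_zero_right add_0)
  qed
  \<comment> \<open>By orthogonality only the \<gamma> term of the recurrence survives, so this
    value is a product of positive \<gamma>.\<close>
  have lead: "0 < poly_functional s (p n * monom 1 n)" for n
  proof (induction n)
    case 0
    then show ?case
      by (simp add: p0 poly_functional_one s0)
  next
    case (Suc n)
    then show ?case
      using \<gamma> [of "Suc n"] by (simp only: shift) (simp add: orth)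
  qed
  have "0 < poly_functional s (p n * p n)" for n
  proof -
    \<comment> \<open>The difference \<open>p n - monom 1 n\<close> has lower degree, so
      \<open>p n * p n\<close> has the same value as \<open>p n * monom 1 n\<close>.\<close>
    have "poly_functional s (p n * (p n - monom 1 n)) = 0"
    proof (rule poly_functional_mult_eq_0 [where n = n])
      show "coeff (p n - monom 1 n) i = 0" if "n \<le> i" for i
        using that monic [of n] by (cases "i = n") (auto simp: coeff_eq_0)
    qed (rule orth)
    then show ?thesis
      using lead [of n] by (simp add: right_diff_distrib poly_functional_diff)
  qed
  then interpret orthogonal_polynomials s p
    by unfold_locales (use monic orth in auto)
  from exists_representing_measure [OF s0] show ?thesis
    using s0 orth by metis
qed

section \<open>Normality\<close>

lemma integral_poly:
  assumes "finite_moments_measure \<mu>"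
  shows "(\<integral>x. poly r x \<partial>\<mu>) = poly_functional (moment \<mu>) r"
  using assms unfolding finite_moments_measure_def poly_functional_def moment_def poly_altdef
  by (subst Bochner_Integration.integral_sum) auto

lemma integral_poly_mult_power:
  assumes "finite_moments_measure \<mu>"
  shows "(\<integral>x. poly r x * x ^ j \<partial>\<mu>) = poly_functional (moment \<mu>) (r * monom 1 j)"
  using integral_poly [OF assms, of "r * monom 1 j"] by (simp add: poly_monom)

lemma poly_functional_mult_monom:
  assumes "\<And>i. i \<ge> N \<Longrightarrow> coeff r i = 0"
  shows "poly_functional s (r * monom 1 j) = (\<Sum>i<N. coeff r i * s (i + j))"
proof -
  have "r = (\<Sum>i<N. monom (coeff r i) i)"
    by (rule poly_eqI) (use assms in \<open>auto simp: coeff_sum not_less [symmetric]\<close>)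
  then have "r * monom 1 j = (\<Sum>i<N. monom (coeff r i) i) * monom 1 j"
    by (rule arg_cong)
  also have "\<dots> = (\<Sum>i<N. Polynomial.smult (coeff r i) (monom 1 (i + j)))"
    by (simp add: sum_distrib_right mult_monom smult_monom)
  finally have "r * monom 1 j = \<dots>" .
  then show ?thesis
    by (simp add: poly_functional_sum poly_functional_smult poly_functional_monom)
qed

text \<open>Normality as triviality of the kernel of the transposed moment matrix, a vector being
  read as the coefficients of a polynomial. The coefficient bound, unlike a degree bound, also
  leaves only \<open>r = 0\<close> when \<open>n + m = 0\<close>.\<close>

definition only_zero_orthogonal :: "(nat \<Rightarrow> real) \<Rightarrow> (nat \<Rightarrow> real) \<Rightarrow> nat \<Rightarrow> nat \<Rightarrow> bool" where
  "only_zero_orthogonal s t n m \<longleftrightarrow> (\<forall>r.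
     (\<forall>i\<ge>n + m. coeff r i = 0) \<longrightarrow>
     (\<forall>j<n. poly_functional s (r * monom 1 j) = 0) \<longrightarrow>
     (\<forall>j<m. poly_functional t (r * monom 1 j) = 0) \<longrightarrow> r = 0)"

text \<open>Each column of the moment matrix encodes one orthogonality condition, so the transpose
  maps a coefficient vector to the values of the functionals on \<open>r\<close> times monomials.
  The determinant vanishes exactly when this map has a nonzero kernel vector.\<close>

lemma normal_index_iff:
  "normal_index \<mu>1 \<mu>2 n m \<longleftrightarrow> only_zero_orthogonal (moment \<mu>1) (moment \<mu>2) n m"
proof -
  define N A where "N = n + m" and "A = moment_matrix \<mu>1 \<mu>2 n m"
  have A: "A \<in> carrier_mat N N"
    by (simp add: A_def moment_matrix_def N_def)
  have product: "transpose_mat A *\<^sub>v v = 0\<^sub>v N \<longleftrightarrow>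
      (\<forall>j<n. poly_functional (moment \<mu>1) (r * monom 1 j) = 0) \<and>
      (\<forall>j<m. poly_functional (moment \<mu>2) (r * monom 1 j) = 0)"
    if v: "v \<in> carrier_vec N" and r: "\<And>i. i \<ge> N \<Longrightarrow> coeff r i = 0" "\<And>i. i < N \<Longrightarrow> coeff r i = vec_index v i"
    for v r
  proof -
    have sums: "poly_functional s (r * monom 1 j) = (\<Sum>i<N. coeff r i * s (i + j))" for s j
      by (rule poly_functional_mult_monom) (rule r)
    have "vec_index (transpose_mat A *\<^sub>v v) j =
        (if j < n then poly_functional (moment \<mu>1) (r * monom 1 j)
         else poly_functional (moment \<mu>2) (r * monom 1 (j - n)))" if "j < N" for j
      unfolding sums using that v A
      by (auto simp: scalar_prod_def A_def moment_matrix_def N_def r(2) [unfolded N_def] mult.commute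
          lessThan_atLeast0 intro!: sum.cong)
    then have "transpose_mat A *\<^sub>v v = 0\<^sub>v N \<longleftrightarrow> (\<forall>j<N. (if j < n then poly_functional (moment \<mu>1) (r * monom 1 j)
         else poly_functional (moment \<mu>2) (r * monom 1 (j - n))) = 0)"
      using A v by (auto simp: vec_eq_iff)
    also have "\<dots> \<longleftrightarrow> (\<forall>j<n. poly_functional (moment \<mu>1) (r * monom 1 j) = 0) \<and>
      (\<forall>j<m. poly_functional (moment \<mu>2) (r * monom 1 j) = 0)"
      unfolding N_def
      by (auto split: if_splits) (metis add_diff_cancel_left' add_less_cancel_left not_add_less1)
    finally show ?thesis .
  qed
  have "Determinant.det A = 0 \<longleftrightarrow> (\<exists>v. v \<in> carrier_vec N \<and> v \<noteq> 0\<^sub>v N \<and> transpose_mat A *\<^sub>v v = 0\<^sub>v N)"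
    using det_0_iff_vec_prod_zero_field [of "transpose_mat A" N] Determinant.det_transpose [OF A] A by simp
  also have "\<dots> \<longleftrightarrow> \<not> only_zero_orthogonal (moment \<mu>1) (moment \<mu>2) n m"
  proof
    assume "\<exists>v. v \<in> carrier_vec N \<and> v \<noteq> 0\<^sub>v N \<and> transpose_mat A *\<^sub>v v = 0\<^sub>v N"
    then obtain v where v: "v \<in> carrier_vec N" "v \<noteq> 0\<^sub>v N" "transpose_mat A *\<^sub>v v = 0\<^sub>v N"
      by blast
    define r where "r = (\<Sum>i<N. monom (vec_index v i) i)"
    have r: "coeff r i = (if i < N then vec_index v i else 0)" for i
      by (auto simp: r_def coeff_sum)
    have "r \<noteq> 0"
    proof
      assume "r = 0"
      then have "vec_index v i = 0" if "i < N" for i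
        using r [of i] that by simp
      with v show False
        by (auto simp: vec_eq_iff)
    qed
    moreover have "(\<forall>j<n. poly_functional (moment \<mu>1) (r * monom 1 j) = 0) \<and>
      (\<forall>j<m. poly_functional (moment \<mu>2) (r * monom 1 j) = 0)"
      using product [OF v(1), of r] v(3) by (simp add: r)
    ultimately show "\<not> only_zero_orthogonal (moment \<mu>1) (moment \<mu>2) n m"
      unfolding only_zero_orthogonal_def using r by (auto simp: N_def intro!: exI [of _ r])
  next
    assume "\<not> only_zero_orthogonal (moment \<mu>1) (moment \<mu>2) n m"
    then obtain r where r: "\<And>i. i \<ge> N \<Longrightarrow> coeff r i = 0" "r \<noteq> 0"
      and orth: "\<forall>j<n. poly_functional (moment \<mu>1) (r * monom 1 j) = 0"
        "\<forall>j<m. poly_functional (moment \<mu>2) (r * monom 1 j) = 0"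
      unfolding only_zero_orthogonal_def N_def by blast
    define v where "v = Matrix.vec N (coeff r)"
    have "v \<noteq> 0\<^sub>v N"
    proof
      assume "v = 0\<^sub>v N"
      then have "coeff r i = 0" if "i < N" for i
        by (metis index_vec index_zero_vec(1) that v_def)
      with r show False
        by (metis leading_coeff_0_iff not_less)
    qed
    then show "\<exists>v. v \<in> carrier_vec N \<and> v \<noteq> 0\<^sub>v N \<and> transpose_mat A *\<^sub>v v = 0\<^sub>v N"
      using product [of v r] r(1) orth by (intro exI [of _ v]) (auto simp: v_def)
  qed
  finally show ?thesis
    unfolding normal_index_def A_def by blast
qed

section \<open>Zero curvature and nearest neighbour recurrences\<close>

text \<open>The lower right 2 by 2 blocks of the two products agree identically; the other five
  entries are the listed equations.\<close>

lemma mat_of_rows_list_zero_curvature: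
  fixes z :: "'a :: comm_ring_1"
  shows "mat_of_rows_list 3 [[z - c', - a', - b'], [1, 0, 0], [1, 0, e']]
        * mat_of_rows_list 3 [[z - d, - a, - b], [1, f, 0], [1, 0, 0]]
      - mat_of_rows_list 3 [[z - d'', - a'', - b''], [1, f'', 0], [1, 0, 0]]
        * mat_of_rows_list 3 [[z - c, - a, - b], [1, 0, 0], [1, 0, e]] = 0\<^sub>m 3 3 \<longleftrightarrow>
    (z - c') * (z - d) - a' - b' = (z - d'') * (z - c) - a'' - b'' \<and>
    (z - c') * a + a' * f = (z - d'') * a \<and> (z - c') * b = (z - d'') * b + b'' * e \<and>
    z - d = z - c + f'' \<and> z - d + e' = z - c"
  by (auto simp: mat_eq_iff mat_of_rows_list_def scalar_prod_def numeral_3_eq_3 All_less_Suc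
      sum.atLeast0_lessThan_Suc algebra_simps)

text \<open>Truncated subtraction: \<open>n - 1\<close> and \<open>m - 1\<close> are only meaningful for positive indices, but
  \<open>a 0 m = 0\<close> and \<open>b n 0 = 0\<close> make the remaining instances of the last two conditions trivial.\<close>

definition compatible ::
  "(nat \<Rightarrow> nat \<Rightarrow> real) \<Rightarrow> (nat \<Rightarrow> nat \<Rightarrow> real) \<Rightarrow> (nat \<Rightarrow> nat \<Rightarrow> real) \<Rightarrow> (nat \<Rightarrow> nat \<Rightarrow> real) \<Rightarrow> bool" where
  "compatible a b c d \<longleftrightarrow> (\<forall>n m.
     c n (m + 1) - d (n + 1) m = c n m - d n m \<and>
     c n (m + 1) * d n m - a n (m + 1) - b n (m + 1)
       = d (n + 1) m * c n m - a (n + 1) m - b (n + 1) m \<and>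
     a n m * (c n m - d n m) = a n (m + 1) * (c (n - 1) m - d (n - 1) m) \<and>
     b n m * (c n m - d n m) = b (n + 1) m * (c n (m - 1) - d n (m - 1)))"

text \<open>Half of \<open>c - d\<close>; \<open>L_matrix\<close> has the entry \<open>z - (q + h)\<close> and \<open>M_matrix\<close> the entry \<open>z - (q - h)\<close>.\<close>

definition half_gap ::
  "(nat \<Rightarrow> nat \<Rightarrow> real) \<Rightarrow> (nat \<Rightarrow> nat \<Rightarrow> real) \<Rightarrow> (nat \<Rightarrow> nat \<Rightarrow> real) \<Rightarrow> nat \<Rightarrow> nat \<Rightarrow> real" where
  "half_gap a b q n m = - 4 * (q (n + 1) m - q n (m + 1)) / D_coeff a b n m"

text \<open>The diagonal entries \<open>e\<close> and \<open>f\<close> satisfy the two equations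
  from the first column, below the corner, by construction. What remains is polynomial in
  \<open>z\<close>, and its coefficients are recovered from \<open>z = 0\<close> and
  \<open>z = 1\<close>.\<close>

lemma zero_curvature_iff_compatible:
  fixes a b q :: "nat \<Rightarrow> nat \<Rightarrow> real"
  assumes a0: "\<And>m. a 0 m = 0" and b0: "\<And>n. b n 0 = 0"
  defines "h \<equiv> half_gap a b q"
  shows "(\<forall>(z :: complex) n m.
      L_matrix a b q z n (m + 1) * M_matrix a b q z n m
      - M_matrix a b q z (n + 1) m * L_matrix a b q z n m = 0\<^sub>m 3 3)
    \<longleftrightarrow> compatible a b (\<lambda>n m. q n m + h n m) (\<lambda>n m. q n m - h n m)"
proof -
  define c d where "c = (\<lambda>n m. q n m + h n m)" and "d = (\<lambda>n m. q n m - h n m)"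
  \<comment> \<open>The boundary value 0 is harmless: in the first row \<open>e n 0\<close> is
    multiplied by \<open>b (n + 1) 0 = 0\<close> and \<open>f 0 m\<close> by
    \<open>a 0 (m + 1) = 0\<close>.\<close>
  define e f where "e n m = (if m = 0 then 0 else - (c n (m - 1) - d n (m - 1)))"
    and "f n m = (if n = 0 then 0 else c (n - 1) m - d (n - 1) m)" for n m :: nat
  have L: "L_matrix a b q z n m = mat_of_rows_list 3
      [[z - of_real (c n m), - of_real (a n m), - of_real (b n m)], [1, 0, 0], [1, 0, of_real (e n m)]]" for z n m
    unfolding L_matrix_def c_def d_def e_def h_def half_gap_def
    by (cases m) (simp_all add: diff_divide_distrib algebra_simps)
  have M: "M_matrix a b q z n m = mat_of_rows_list 3
      [[z - of_real (d n m), - of_real (a n m), - of_real (b n m)], [1, of_real (f n m), 0], [1, 0, 0]]" for z n m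
    unfolding M_matrix_def c_def d_def f_def h_def half_gap_def
    by (cases n) (simp_all add: diff_divide_distrib algebra_simps)
  have entries: "L_matrix a b q z n (m + 1) * M_matrix a b q z n m
      - M_matrix a b q z (n + 1) m * L_matrix a b q z n m = 0\<^sub>m 3 3 \<longleftrightarrow>
    (z - of_real (c n (m + 1))) * (z - of_real (d n m)) - of_real (a n (m + 1)) - of_real (b n (m + 1))
      = (z - of_real (d (n + 1) m)) * (z - of_real (c n m)) - of_real (a (n + 1) m) - of_real (b (n + 1) m) \<and>
    (z - of_real (c n (m + 1))) * of_real (a n m) + of_real (a n (m + 1)) * of_real (f n m)
      = (z - of_real (d (n + 1) m)) * of_real (a n m) \<and>
    (z - of_real (c n (m + 1))) * of_real (b n m)
      = (z - of_real (d (n + 1) m)) * of_real (b n m) + of_real (b (n + 1) m) * of_real (e n m)" for z n m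
    unfolding L M mat_of_rows_list_zero_curvature by (simp add: e_def f_def)
  have "(\<forall>z. L_matrix a b q z n (m + 1) * M_matrix a b q z n m
      - M_matrix a b q z (n + 1) m * L_matrix a b q z n m = 0\<^sub>m 3 3) \<longleftrightarrow>
     c n (m + 1) - d (n + 1) m = c n m - d n m \<and>
     c n (m + 1) * d n m - a n (m + 1) - b n (m + 1)
       = d (n + 1) m * c n m - a (n + 1) m - b (n + 1) m \<and>
     a n m * (c n m - d n m) = a n (m + 1) * (c (n - 1) m - d (n - 1) m) \<and>
     b n m * (c n m - d n m) = b (n + 1) m * (c n (m - 1) - d n (m - 1))"
    (is "?curv \<longleftrightarrow> ?comp") for n m
  proof
    assume curv: ?curv
    have 0: "c n (m + 1) * d n m - a n (m + 1) - b n (m + 1)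
       = d (n + 1) m * c n m - a (n + 1) m - b (n + 1) m"
      "a n (m + 1) * f n m = (c n (m + 1) - d (n + 1) m) * a n m"
      "- (b (n + 1) m * e n m) = (c n (m + 1) - d (n + 1) m) * b n m"
      using curv [rule_format, of 0] unfolding entries
      by (simp_all add: algebra_simps flip: of_real_mult of_real_diff of_real_add of_real_minus del: One_nat_def Suc_eq_plus1)
    \<comment> \<open>Subtracting the identity at \<open>z = 0\<close> from the one at
      \<open>z = 1\<close> isolates the linear coefficient of the corner entry.\<close>
    have "of_real ((1 - c n (m + 1)) * (1 - d n m) - a n (m + 1) - b n (m + 1))
        = (of_real ((1 - d (n + 1) m) * (1 - c n m) - a (n + 1) m - b (n + 1) m) :: complex)"
      using curv [rule_format, of 1] unfolding entries by simp
    then have "(1 - c n (m + 1)) * (1 - d n m) - a n (m + 1) - b n (m + 1)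
        = (1 - d (n + 1) m) * (1 - c n m) - a (n + 1) m - b (n + 1) m"
      by (simp only: of_real_eq_iff)
    with 0(1) have 1: "c n (m + 1) - d (n + 1) m = c n m - d n m"
      by (simp add: algebra_simps)
    show ?comp
    proof (intro conjI)
      show "a n m * (c n m - d n m) = a n (m + 1) * (c (n - 1) m - d (n - 1) m)"
        using 0(2) 1 a0 by (cases n) (simp_all add: f_def)
      show "b n m * (c n m - d n m) = b (n + 1) m * (c n (m - 1) - d n (m - 1))"
      proof -
        have "b n m * (c n m - d n m) = - (b (n + 1) m * e n m)"
          unfolding 0(3) 1 by (rule mult.commute)
        then show ?thesis
          using b0 by (cases m) (simp_all add: e_def algebra_simps)
      qed
    qed (fact 0 1)+
  next
    assume comp: ?comp
    then have 1: "c n (m + 1) = d (n + 1) m + c n m - d n m"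
      and 0: "c n (m + 1) * d n m - a n (m + 1) - b n (m + 1)
       = d (n + 1) m * c n m - a (n + 1) m - b (n + 1) m"
      by linarith+
    have f: "a n (m + 1) * f n m = (c n m - d n m) * a n m"
      using comp a0 by (cases n) (simp_all add: f_def mult.commute)
    have e: "b (n + 1) m * e n m = - ((c n m - d n m) * b n m)"
      using comp b0 by (cases m) (simp_all add: e_def algebra_simps)
    show ?curv
    proof (intro allI, unfold entries, intro conjI)
      fix z :: complex
      have sum: "of_real (c n (m + 1)) + of_real (d n m) = (of_real (d (n + 1) m) + of_real (c n m) :: complex)"
        unfolding of_real_add [symmetric] 1 by simp
      have "(z - of_real (c n (m + 1))) * (z - of_real (d n m)) - of_real (a n (m + 1)) - of_real (b n (m + 1))
          = z * z - (of_real (c n (m + 1)) + of_real (d n m)) * z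
            + of_real (c n (m + 1) * d n m - a n (m + 1) - b n (m + 1))"
        by (simp add: algebra_simps)
      also have "\<dots> = (z - of_real (d (n + 1) m)) * (z - of_real (c n m)) - of_real (a (n + 1) m) - of_real (b (n + 1) m)"
        unfolding sum 0 by (simp add: algebra_simps)
      finally show "(z - of_real (c n (m + 1))) * (z - of_real (d n m)) - of_real (a n (m + 1)) - of_real (b n (m + 1))
          = (z - of_real (d (n + 1) m)) * (z - of_real (c n m)) - of_real (a (n + 1) m) - of_real (b (n + 1) m)" .
      have "of_real (a n (m + 1)) * of_real (f n m) = ((of_real (c n m) - of_real (d n m)) * of_real (a n m) :: complex)"
        using arg_cong [OF f, of "of_real :: real \<Rightarrow> complex"] by simp
      then show "(z - of_real (c n (m + 1))) * of_real (a n m) + of_real (a n (m + 1)) * of_real (f n m)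
          = (z - of_real (d (n + 1) m)) * of_real (a n m)"
        unfolding 1 by (simp add: algebra_simps)
      have "of_real (b (n + 1) m) * of_real (e n m) = (- ((of_real (c n m) - of_real (d n m)) * of_real (b n m)) :: complex)"
        using arg_cong [OF e, of "of_real :: real \<Rightarrow> complex"] by simp
      then show "(z - of_real (c n (m + 1))) * of_real (b n m)
          = (z - of_real (d (n + 1) m)) * of_real (b n m) + of_real (b (n + 1) m) * of_real (e n m)"
        unfolding 1 by (simp add: algebra_simps)
    qed
  qed
  then show ?thesis
    unfolding compatible_def c_def [symmetric] d_def [symmetric] by blast
qed

text \<open>The second equation is the difference of the recurrences in the two directions, so the
  one with \<open>d\<close> is implied. The truncated indices are harmless when
  \<open>a 0 m = 0\<close> and \<open>b n 0 = 0\<close>.\<close>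

definition nearest_neighbour ::
  "(nat \<Rightarrow> nat \<Rightarrow> real) \<Rightarrow> (nat \<Rightarrow> nat \<Rightarrow> real) \<Rightarrow> (nat \<Rightarrow> nat \<Rightarrow> real) \<Rightarrow> (nat \<Rightarrow> nat \<Rightarrow> real) \<Rightarrow>
    (nat \<Rightarrow> nat \<Rightarrow> real poly) \<Rightarrow> bool" where
  "nearest_neighbour a b c d P \<longleftrightarrow> (\<forall>n m.
     [:0, 1:] * P n m = P (n + 1) m + Polynomial.smult (c n m) (P n m)
       + Polynomial.smult (a n m) (P (n - 1) m) + Polynomial.smult (b n m) (P n (m - 1)) \<and>
     P n (m + 1) = P (n + 1) m + Polynomial.smult (c n m - d n m) (P n m))"

lemma nearest_neighbourD:
  assumes "nearest_neighbour a b c d P"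
  shows "[:0, 1:] * P n m = P (n + 1) m + Polynomial.smult (c n m) (P n m)
       + Polynomial.smult (a n m) (P (n - 1) m) + Polynomial.smult (b n m) (P n (m - 1))"
    and "P n (m + 1) = P (n + 1) m + Polynomial.smult (c n m - d n m) (P n m)"
  using assms unfolding nearest_neighbour_def by blast+

text \<open>This symmetry lets every argument about the first index and \<mu>1 be reused for the
  second index and \<mu>2.\<close>

lemma nearest_neighbour_swap:
  assumes "nearest_neighbour a b c d P"
  shows "nearest_neighbour (\<lambda>n m. b m n) (\<lambda>n m. a m n) (\<lambda>n m. d m n) (\<lambda>n m. c m n) (\<lambda>n m. P m n)"
  unfolding nearest_neighbour_def nearest_neighbourD(1) [OF assms]
  by (auto simp: nearest_neighbourD(2) [OF assms, simplified] smult_diff_left algebra_simps)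

text \<open>Expanding \<open>x\<close> times \<open>P n (m + 1)\<close> in two ways gives a linear
  relation between \<open>P (n + 1) m\<close>, \<open>P n m\<close>, \<open>P (n - 1) m\<close> and
  \<open>P n (m - 1)\<close>. The two highest coefficients kill \<alpha> and \<beta>. For positive
  \<open>n\<close> and \<open>m\<close> the last two polynomials are monic of equal degree and
  differ by a nonzero multiple of \<open>P (n - 1) (m - 1)\<close>, so their coefficients vanish as
  well.\<close>

lemma compatible_of_nearest_neighbour:
  assumes nn: "nearest_neighbour a b c d P"
    and a0: "\<And>m. a 0 m = 0" and b0: "\<And>n. b n 0 = 0" and cd: "\<And>n m. c n m \<noteq> d n m"
    and deg: "\<And>n m. degree (P n m) = n + m" and monic: "\<And>n m. coeff (P n m) (n + m) = 1"
  shows "compatible a b c d"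
  unfolding compatible_def
proof (intro allI)
  fix n m
  define \<delta> where "\<delta> n m = c n m - d n m" for n m
  define \<alpha> where "\<alpha> = c n (m + 1) - d (n + 1) m - \<delta> n m"
  define \<beta> where "\<beta> = c n (m + 1) * d n m - a n (m + 1) - b n (m + 1) - (d (n + 1) m * c n m - a (n + 1) m - b (n + 1) m)"
  define \<gamma> where "\<gamma> = a n (m + 1) * \<delta> (n - 1) m - a n m * \<delta> n m"
  define \<epsilon> where "\<epsilon> = b (n + 1) m * \<delta> n (m - 1) - b n m * \<delta> n m"
  have rec: "x * poly (P n m) x = poly (P (n + 1) m) x + c n m * poly (P n m) x
      + a n m * poly (P (n - 1) m) x + b n m * poly (P n (m - 1)) x" for n m x
    using arg_cong [OF nearest_neighbourD(1) [OF nn, of n m], of "\<lambda>p. poly p x"] by simp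
  have step: "poly (P n (m + 1)) x = poly (P (n + 1) m) x + \<delta> n m * poly (P n m) x" for n m x
    unfolding \<delta>_def using arg_cong [OF nearest_neighbourD(2) [OF nn, of n m], of "\<lambda>p. poly p x"] by simp
  \<comment> \<open>The factor \<open>a n (m + 1)\<close> makes the relation valid at
    \<open>n = 0\<close> too, where \<open>n - 1\<close> is truncated.\<close>
  have a_step: "a n (m + 1) * poly (P (n - 1) (m + 1)) x
      = a n (m + 1) * (poly (P n m) x + \<delta> (n - 1) m * poly (P (n - 1) m) x)" for x
    using step [of "n - 1" m x] a0 by (cases n) simp_all
  have b_step: "b (n + 1) m * poly (P (n + 1) (m - 1)) x
      = b (n + 1) m * (poly (P n m) x - \<delta> n (m - 1) * poly (P n (m - 1)) x)" for x
    using step [of n "m - 1" x] b0 by (cases m) simp_all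
  have relation_poly: "Polynomial.smult \<alpha> (P (n + 1) m) + Polynomial.smult (c n m * \<alpha> - \<beta>) (P n m)
      + Polynomial.smult \<gamma> (P (n - 1) m) + Polynomial.smult \<epsilon> (P n (m - 1)) = 0" (is "?R = 0")
  proof -
    have "poly ?R x = 0" for x
    proof -
      have "x * poly (P n (m + 1)) x = x * poly (P (n + 1) m) x
          + \<delta> n m * (poly (P (n + 1) m) x + c n m * poly (P n m) x
            + a n m * poly (P (n - 1) m) x + b n m * poly (P n (m - 1)) x)"
        unfolding step rec [symmetric] by (simp add: algebra_simps)
      moreover have "x * poly (P n (m + 1)) x = poly (P (n + 1 + 1) m) x + \<delta> (n + 1) m * poly (P (n + 1) m) x
          + c n (m + 1) * (poly (P (n + 1) m) x + \<delta> n m * poly (P n m) x)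
          + a n (m + 1) * (poly (P n m) x + \<delta> (n - 1) m * poly (P (n - 1) m) x) + b n (m + 1) * poly (P n m) x"
        unfolding rec a_step by (simp only: step add_diff_cancel_right')
      moreover have "x * poly (P (n + 1) m) x = poly (P (n + 1 + 1) m) x + c (n + 1) m * poly (P (n + 1) m) x
          + a (n + 1) m * poly (P n m) x
          + b (n + 1) m * (poly (P n m) x - \<delta> n (m - 1) * poly (P n (m - 1)) x)"
        unfolding rec b_step by (simp only: add_diff_cancel_right')
      ultimately show ?thesis
        by (simp add: \<alpha>_def \<beta>_def \<gamma>_def \<epsilon>_def \<delta>_def algebra_simps)
    qed
    then show ?thesis
      using poly_all_0_iff_0 by blast
  qed
  have relation: "\<alpha> * coeff (P (n + 1) m) i + (c n m * \<alpha> - \<beta>) * coeff (P n m) i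
      + \<gamma> * coeff (P (n - 1) m) i + \<epsilon> * coeff (P n (m - 1)) i = 0" for i
    using arg_cong [OF relation_poly, of "\<lambda>p. coeff p i"] by simp
  have high: "coeff (P n m) i = 0" if "n + m < i" for n m i
    using that deg by (simp add: coeff_eq_0)
  have \<alpha>: "\<alpha> = 0"
    using relation [of "n + 1 + m"] monic [of "n + 1" m] high [of n m "n + 1 + m"]
      high [of "n - 1" m "n + 1 + m"] high [of n "m - 1" "n + 1 + m"] by simp
  \<comment> \<open>For \<open>n = 0\<close> the truncated index gives a polynomial of degree
    \<open>n + m\<close>, but then \<gamma> is 0; otherwise the degree is too small.\<close>
  have "\<gamma> * coeff (P (n - 1) m) (n + m) = 0"
    using a0 high by (cases n) (simp_all add: \<gamma>_def)
  moreover have "\<epsilon> * coeff (P n (m - 1)) (n + m) = 0"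
    using b0 high by (cases m) (simp_all add: \<epsilon>_def)
  ultimately have \<beta>: "\<beta> = 0"
    using relation [of "n + m"] monic [of n m] \<alpha> by auto
  have rest: "\<gamma> * coeff (P (n - 1) m) i + \<epsilon> * coeff (P n (m - 1)) i = 0" for i
    using relation [of i] \<alpha> \<beta> by simp
  have "\<gamma> = 0 \<and> \<epsilon> = 0"
  proof (cases "n = 0 \<or> m = 0")
    case True
    then show ?thesis
    proof
      assume n: "n = 0"
      then have "\<gamma> = 0"
        by (simp add: \<gamma>_def a0)
      then show ?thesis
        using rest [of "n + (m - 1)"] monic [of n "m - 1"] by simp
    next
      assume m: "m = 0"
      then have "\<epsilon> = 0"
        by (simp add: \<epsilon>_def b0)
      then show ?thesis
        using rest [of "n - 1 + m"] monic [of "n - 1" m] by simp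
    qed
  next
    case False
    then obtain k l where kl: "n = Suc k" "m = Suc l"
      using not0_implies_Suc by blast
    have "\<gamma> + \<epsilon> = 0"
      using rest [of "k + l + 1"] monic [of k "Suc l"] monic [of "Suc k" l] kl by simp
    then have \<epsilon>: "\<epsilon> = - \<gamma>"
      by linarith
    have "coeff (P k (Suc l)) (k + l) = coeff (P (Suc k) l) (k + l) + \<delta> k l"
      using nearest_neighbourD(2) [OF nn, of k l] monic [of k l] by (simp add: \<delta>_def)
    then have "\<gamma> * \<delta> k l = 0"
      using rest [of "k + l"] kl \<epsilon> by (simp add: algebra_simps)
    then show ?thesis
      using cd [of k l] \<epsilon> by (simp add: \<delta>_def)
  qed
  with \<alpha> \<beta> show "c n (m + 1) - d (n + 1) m = c n m - d n m \<and>
     c n (m + 1) * d n m - a n (m + 1) - b n (m + 1)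
       = d (n + 1) m * c n m - a (n + 1) m - b (n + 1) m \<and>
     a n m * (c n m - d n m) = a n (m + 1) * (c (n - 1) m - d (n - 1) m) \<and>
     b n m * (c n m - d n m) = b (n + 1) m * (c n (m - 1) - d n (m - 1))"
    unfolding \<alpha>_def \<beta>_def \<gamma>_def \<epsilon>_def \<delta>_def by linarith
qed

text \<open>The row \<open>m = 0\<close> is built from its three-term recurrence, and each further
  row from the relation between neighbours, so only the recurrence in \<open>n\<close> for positive
  \<open>m\<close> is left to prove.\<close>

fun nn_family :: "(nat \<Rightarrow> nat \<Rightarrow> real) \<Rightarrow> (nat \<Rightarrow> nat \<Rightarrow> real) \<Rightarrow> (nat \<Rightarrow> nat \<Rightarrow> real) \<Rightarrow> nat \<Rightarrow> nat \<Rightarrow> real poly" where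
  "nn_family a c \<delta> 0 0 = 1"
| "nn_family a c \<delta> (Suc n) 0 = [:- c n 0, 1:] * nn_family a c \<delta> n 0
     - Polynomial.smult (a n 0) (nn_family a c \<delta> (n - 1) 0)"
| "nn_family a c \<delta> n (Suc m) = nn_family a c \<delta> (Suc n) m + Polynomial.smult (\<delta> n m) (nn_family a c \<delta> n m)"

text \<open>Compatibility is exactly what carries the recurrence from row \<open>m\<close> to row
  \<open>m + 1\<close>.\<close>

lemma nearest_neighbour_nn_family:
  assumes comp: "compatible a b c d" and a0: "\<And>m. a 0 m = 0" and b0: "\<And>n. b n 0 = 0"
  shows "nearest_neighbour a b c d (nn_family a c (\<lambda>n m. c n m - d n m))"
proof -
  define \<delta> where "\<delta> n m = c n m - d n m" for n m
  define P where "P = nn_family a c \<delta>"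
  have step: "poly (P n (m + 1)) x = poly (P (n + 1) m) x + \<delta> n m * poly (P n m) x" for n m x
    by (simp add: P_def)
  have rec: "x * poly (P n m) x = poly (P (n + 1) m) x + c n m * poly (P n m) x
      + a n m * poly (P (n - 1) m) x + b n m * poly (P n (m - 1)) x" for n m x
  proof (induction m arbitrary: n)
    case 0
    then show ?case
      by (simp add: P_def b0 algebra_simps)
  next
    case (Suc m)
    have eqs: "c n (m + 1) - d (n + 1) m = c n m - d n m"
      "c n (m + 1) * d n m - a n (m + 1) - b n (m + 1) = d (n + 1) m * c n m - a (n + 1) m - b (n + 1) m"
      "a n m * \<delta> n m = a n (m + 1) * \<delta> (n - 1) m" "b n m * \<delta> n m = b (n + 1) m * \<delta> n (m - 1)"
      using comp unfolding compatible_def \<delta>_def by blast+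
    have a_step: "a n (m + 1) * poly (P (n - 1) (m + 1)) x
        = a n (m + 1) * poly (P n m) x + a n m * \<delta> n m * poly (P (n - 1) m) x"
      using step [of "n - 1" m x] a0 eqs(3) by (cases n) (simp_all add: algebra_simps)
    have b_step: "b (n + 1) m * poly (P (n + 1) (m - 1)) x
        = b (n + 1) m * poly (P n m) x - b n m * \<delta> n m * poly (P n (m - 1)) x"
      using step [of n "m - 1" x] b0 eqs(4) by (cases m) (simp_all add: algebra_simps)
    \<comment> \<open>The equations are solved for the coefficients of row \<open>m + 1\<close>. The
      second still contains \<open>c n (m + 1)\<close>, so it is unfolded before the first.\<close>
    have c': "c n (m + 1) = d (n + 1) m + c n m - d n m"
      using eqs(1) by linarith
    have b': "b n (m + 1) = c n (m + 1) * d n m - a n (m + 1) - (d (n + 1) m * c n m - a (n + 1) m - b (n + 1) m)"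
      using eqs(2) by linarith
    have "x * poly (P n (m + 1)) x = x * poly (P (n + 1) m) x + \<delta> n m * (x * poly (P n m) x)"
      unfolding step by (simp add: algebra_simps)
    also have "x * poly (P (n + 1) m) x = poly (P (n + 1 + 1) m) x + c (n + 1) m * poly (P (n + 1) m) x
        + a (n + 1) m * poly (P n m) x
        + (b (n + 1) m * poly (P n m) x - b n m * \<delta> n m * poly (P n (m - 1)) x)"
      unfolding Suc.IH b_step by (simp only: add_diff_cancel_right')
    also have "x * poly (P n m) x = poly (P (n + 1) m) x + c n m * poly (P n m) x
      + a n m * poly (P (n - 1) m) x + b n m * poly (P n (m - 1)) x"
      by (rule Suc.IH)
    finally have "x * poly (P n (m + 1)) x = poly (P (n + 1) (m + 1)) x + c n (m + 1) * poly (P n (m + 1)) x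
        + a n (m + 1) * poly (P (n - 1) (m + 1)) x + b n (m + 1) * poly (P n m) x"
      unfolding a_step unfolding step unfolding b' unfolding c' \<delta>_def by (simp add: algebra_simps)
    then show ?case
      by simp
  qed
  have "[:0, 1:] * P n m = P (n + 1) m + Polynomial.smult (c n m) (P n m)
       + Polynomial.smult (a n m) (P (n - 1) m) + Polynomial.smult (b n m) (P n (m - 1))" for n m
    unfolding poly_eq_poly_eq_iff [symmetric] fun_eq_iff using rec by simp
  moreover have "P n (m + 1) = P (n + 1) m + Polynomial.smult (\<delta> n m) (P n m)" for n m
    by (simp add: P_def)
  ultimately show ?thesis
    unfolding nearest_neighbour_def P_def \<delta>_def by simp
qed

section \<open>Orthogonality along the recurrence and normality of all indices\<close>

lemma nearest_neighbour_monic_degree: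
  assumes nn: "nearest_neighbour a b c d P" and b0: "\<And>n. b n 0 = 0" and P0: "P 0 0 = 1"
  shows "degree (P n m) = n + m \<and> coeff (P n m) (n + m) = 1"
proof (induction m arbitrary: n)
  case 0
  have "[:0, 1:] * P n 0 = P (n + 1) 0 + Polynomial.smult (c n 0) (P n 0)
      + Polynomial.smult (a n 0) (P (n - 1) 0)" for n
    unfolding nearest_neighbourD(1) [OF nn] by (simp add: b0)
  from monic_degree_recurrence [of "\<lambda>n. P n 0", OF P0 this] show ?case
    by simp
next
  case (Suc m)
  have step: "P n (Suc m) = P (Suc n) m + Polynomial.smult (c n m - d n m) (P n m)"
    using nearest_neighbourD(2) [OF nn, of n m] by simp
  have IH: "degree (P (Suc n) m) = Suc (n + m)" "coeff (P (Suc n) m) (Suc (n + m)) = 1" "degree (P n m) = n + m"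
    using Suc.IH [of "Suc n"] Suc.IH [of n] by simp_all
  have "degree (P n (Suc m)) = Suc (n + m)"
    unfolding step using IH degree_smult_le [of "c n m - d n m" "P n m"]
    by (subst degree_add_eq_left) auto
  moreover have "coeff (P n (Suc m)) (Suc (n + m)) = 1"
    unfolding step using IH by (simp add: coeff_eq_0)
  ultimately show ?case
    by simp
qed

text \<open>Raising \<open>m\<close> combines \<open>P (n + 1) m\<close> and \<open>P n m\<close>,
  both orthogonal to the powers below \<open>n\<close>.\<close>

lemma nearest_neighbour_orthogonal:
  assumes nn: "nearest_neighbour a b c d P"
    and base: "\<And>n j. j < n \<Longrightarrow> poly_functional s (P n 0 * monom 1 j) = 0"
  shows "j < n \<Longrightarrow> poly_functional s (P n m * monom 1 j) = 0"
proof (induction m arbitrary: n)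
  case (Suc m)
  then show ?case
    using nearest_neighbourD(2) [OF nn, of n m]
    by (simp add: distrib_right poly_functional_add poly_functional_smult)
qed (rule base)

text \<open>For \<open>n = 0\<close> the functional kills \<open>P 1 m\<close>, so raising
  \<open>m\<close> multiplies the value by \<open>c 0 m - d 0 m\<close>. For larger \<open>n\<close>
  one factor \<open>x\<close> is absorbed by the recurrence, and orthogonality leaves only the term
  with \<open>a\<close>.\<close>

lemma nearest_neighbour_leading:
  assumes nn: "nearest_neighbour a b c d P"
    and orth: "\<And>n m j. j < n \<Longrightarrow> poly_functional s (P n m * monom 1 j) = 0"
    and P0: "poly_functional s (P 0 0) \<noteq> 0"
    and a: "\<And>n m. a (Suc n) m \<noteq> 0" and cd: "\<And>n m. c n m \<noteq> d n m"
  shows "poly_functional s (P n m * monom 1 n) \<noteq> 0"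
proof (induction n arbitrary: m)
  case 0
  show ?case
  proof (induction m)
    case (Suc m)
    have "poly_functional s (P (Suc 0) m) = 0"
      using orth [of 0 "Suc 0" m] by simp
    then show ?case
      using nearest_neighbourD(2) [OF nn, of 0 m] Suc cd [of 0 m]
      by (simp add: poly_functional_add poly_functional_smult)
  qed (simp add: P0)
next
  case (Suc n)
  have "P (Suc n) m * monom 1 (Suc n) = ([:0, 1:] * P (Suc n) m) * monom 1 n"
    by (simp add: monom_Suc)
  also have "poly_functional s \<dots> = a (Suc n) m * poly_functional s (P n m * monom 1 n)"
    unfolding nearest_neighbourD(1) [OF nn]
    by (simp add: distrib_right poly_functional_add poly_functional_smult orth)
  finally show ?case
    using Suc.IH [of m] a [of n m] by simp
qed

lemma only_zero_orthogonalD: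
  assumes "only_zero_orthogonal s t n m" "\<And>i. n + m \<le> i \<Longrightarrow> coeff r i = 0"
    and "\<And>j. j < n \<Longrightarrow> poly_functional s (r * monom 1 j) = 0"
    and "\<And>j. j < m \<Longrightarrow> poly_functional t (r * monom 1 j) = 0"
  shows "r = 0"
  using assms unfolding only_zero_orthogonal_def by blast

lemma only_zero_orthogonal_swap:
  "only_zero_orthogonal s t n m \<longleftrightarrow> only_zero_orthogonal t s m n"
  unfolding only_zero_orthogonal_def by (auto simp: add.commute)

text \<open>Removing the top term of \<open>r\<close> with \<open>p\<close> leaves a polynomial that
  must vanish by the hypothesis at \<open>(n, m)\<close>. So \<open>r\<close> is a multiple of
  \<open>p\<close>, and the new condition at exponent \<open>n\<close> forces the multiple to be
  0.\<close>

lemma only_zero_orthogonal_Suc: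
  assumes oz: "only_zero_orthogonal s t n m"
    and deg: "degree p = n + m" and monic: "coeff p (n + m) = 1"
    and orth: "\<And>j. j < n \<Longrightarrow> poly_functional s (p * monom 1 j) = 0"
      "\<And>j. j < m \<Longrightarrow> poly_functional t (p * monom 1 j) = 0"
    and leading: "poly_functional s (p * monom 1 n) \<noteq> 0"
  shows "only_zero_orthogonal s t (Suc n) m"
  unfolding only_zero_orthogonal_def
proof (intro allI impI)
  fix r
  assume high: "\<forall>i\<ge>Suc n + m. coeff r i = 0"
    and s: "\<forall>j<Suc n. poly_functional s (r * monom 1 j) = 0"
    and t: "\<forall>j<m. poly_functional t (r * monom 1 j) = 0"
  define k where "k = coeff r (n + m)"
  have "r - Polynomial.smult k p = 0"
  proof (rule only_zero_orthogonalD [OF oz])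
    fix i
    assume "n + m \<le> i"
    then show "coeff (r - Polynomial.smult k p) i = 0"
      using high deg monic by (cases "i = n + m") (auto simp: k_def coeff_eq_0)
  qed (use s t orth in \<open>auto simp: left_diff_distrib poly_functional_diff poly_functional_smult\<close>)
  then have r: "r = Polynomial.smult k p"
    by simp
  then have "k * poly_functional s (p * monom 1 n) = 0"
    using s by (auto simp: poly_functional_smult)
  then show "r = 0"
    using leading r by simp
qed

theorem exists_multiple_orthogonal_polynomials:
  assumes comp: "compatible a b c d" and a0: "\<And>m. a 0 m = 0" and b0: "\<And>n. b n 0 = 0"
    and pos: "\<And>n. 0 < n \<Longrightarrow> 0 < a n 0" "\<And>m. 0 < m \<Longrightarrow> 0 < b 0 m"
    and nz: "\<And>n m. a (Suc n) m \<noteq> 0" "\<And>n m. b n (Suc m) \<noteq> 0" and cd: "\<And>n m. c n m \<noteq> d n m"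
  shows "\<exists>\<mu>1 \<mu>2 P. finite_moments_measure \<mu>1 \<and> finite_moments_measure \<mu>2 \<and>
    (\<forall>n m. normal_index \<mu>1 \<mu>2 n m) \<and> (\<forall>n m. type_II_mop \<mu>1 \<mu>2 n m (P n m)) \<and>
    nearest_neighbour a b c d P"
proof -
  define P where "P = nn_family a c (\<lambda>n m. c n m - d n m)"
  have nn: "nearest_neighbour a b c d P"
    unfolding P_def using comp a0 b0 by (rule nearest_neighbour_nn_family)
  note nn' = nearest_neighbour_swap [OF nn]
  have P0: "P 0 0 = 1"
    by (simp add: P_def)
  have monic: "degree (P n m) = n + m" "coeff (P n m) (n + m) = 1" for n m
    using nearest_neighbour_monic_degree [OF nn b0 P0] by auto
  have "[:0, 1:] * P n 0 = P (n + 1) 0 + Polynomial.smult (c n 0) (P n 0)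
      + Polynomial.smult (a n 0) (P (n - 1) 0)" for n
    unfolding nearest_neighbourD(1) [OF nn] by (simp add: b0)
  from favard [of "\<lambda>n. P n 0", OF P0 this pos(1)] obtain \<mu>1 where \<mu>1: "finite_moments_measure \<mu>1" "moment \<mu>1 0 = 1"
    and base1: "\<And>n j. j < n \<Longrightarrow> poly_functional (moment \<mu>1) (P n 0 * monom 1 j) = 0"
    by blast
  have "[:0, 1:] * P 0 m = P 0 (m + 1) + Polynomial.smult (d 0 m) (P 0 m)
      + Polynomial.smult (b 0 m) (P 0 (m - 1))" for m
    unfolding nearest_neighbourD(1) [OF nn'] by (simp add: a0)
  from favard [of "P 0", OF P0 this pos(2)] obtain \<mu>2 where \<mu>2: "finite_moments_measure \<mu>2" "moment \<mu>2 0 = 1"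
    and base2: "\<And>m j. j < m \<Longrightarrow> poly_functional (moment \<mu>2) (P 0 m * monom 1 j) = 0"
    by blast
  have orth1: "poly_functional (moment \<mu>1) (P n m * monom 1 j) = 0" if "j < n" for n m j
    using nearest_neighbour_orthogonal [OF nn base1 that] .
  have orth2: "poly_functional (moment \<mu>2) (P n m * monom 1 j) = 0" if "j < m" for n m j
    using nearest_neighbour_orthogonal [OF nn' base2 that] .
  have lead1: "poly_functional (moment \<mu>1) (P n m * monom 1 n) \<noteq> 0" for n m
    using orth1 by (rule nearest_neighbour_leading [OF nn])
      (simp_all add: P0 poly_functional_one \<mu>1 nz cd)
  have lead2: "poly_functional (moment \<mu>2) (P n m * monom 1 m) \<noteq> 0" for n m
    using orth2 by (rule nearest_neighbour_leading [OF nn'])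
      (simp_all add: P0 poly_functional_one \<mu>2 nz cd [symmetric])
  have normal0: "only_zero_orthogonal (moment \<mu>1) (moment \<mu>2) n 0" for n
  proof (induction n)
    case 0
    show ?case
      by (auto simp: only_zero_orthogonal_def poly_eq_iff)
  next
    case (Suc n)
    then show ?case
      by (rule only_zero_orthogonal_Suc [where p = "P n 0"]) (auto simp: monic [of n 0, simplified] orth1 lead1)
  qed
  \<comment> \<open>From the row \<open>m = 0\<close>, reached with \<mu>1, every index is reached
    by raising \<open>m\<close> with \<mu>2 and the roles swapped.\<close>
  have normal: "only_zero_orthogonal (moment \<mu>1) (moment \<mu>2) n m" for n m
  proof (induction m)
    case (Suc m)
    show ?case
      unfolding only_zero_orthogonal_swap [of "moment \<mu>1"]
      by (rule only_zero_orthogonal_Suc [where p = "P n m"])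
        (use Suc monic [of n m] orth1 orth2 lead2 in
          \<open>auto simp: only_zero_orthogonal_swap [of "moment \<mu>1"] add.commute\<close>)
  qed (rule normal0)
  have "type_II_mop \<mu>1 \<mu>2 n m (P n m)" for n m
    unfolding type_II_mop_def integral_poly_mult_power [OF \<mu>1(1)] integral_poly_mult_power [OF \<mu>2(1)]
    by (simp add: monic orth1 orth2)
  with \<mu>1(1) \<mu>2(1) normal nn show ?thesis
    unfolding normal_index_iff by blast
qed

section \<open>The eigenvalue equation\<close>

lemma cross_diff_op_poly_iff:
  assumes a0: "\<And>m. a 0 m = 0" and b0: "\<And>n. b n 0 = 0"
  shows "(\<forall>z. cross_diff_op a b q (\<lambda>i j. poly (map_poly complex_of_real (P i j)) z) n m
      = z * poly (map_poly complex_of_real (P n m)) z) \<longleftrightarrow>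
    (\<forall>x. 1 / 2 * poly (P (n + 1) m) x + 1 / 2 * poly (P n (m + 1)) x + q n m * poly (P n m) x
      + a n m * poly (P (n - 1) m) x + b n m * poly (P n (m - 1)) x = x * poly (P n m) x)"
proof -
  \<comment> \<open>\<open>Q\<close> is the left side as a real polynomial; an identity at all
    complex \<open>z\<close> is then an identity of polynomials, which real points detect. Vanishing
    coefficients allow truncated indices at the boundary.\<close>
  define Q where "Q = Polynomial.smult (1 / 2) (P (n + 1) m) + Polynomial.smult (1 / 2) (P n (m + 1))
    + Polynomial.smult (q n m) (P n m) + Polynomial.smult (a n m) (P (n - 1) m)
    + Polynomial.smult (b n m) (P n (m - 1))"
  have lhs: "cross_diff_op a b q (\<lambda>i j. poly (map_poly complex_of_real (P i j)) z) n m
      = poly (map_poly complex_of_real Q) z" for z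
    unfolding cross_diff_op_def Q_def poly_map_poly_of_real_add poly_map_poly_of_real_smult
    using a0 b0 by simp
  have rhs: "z * poly (map_poly complex_of_real (P n m)) z
      = poly (map_poly complex_of_real ([:0, 1:] * P n m)) z" for z
    unfolding poly_map_poly_of_real_mult by (simp add: map_poly_pCons)
  have "(\<forall>z. poly (map_poly complex_of_real Q) z = poly (map_poly complex_of_real ([:0, 1:] * P n m)) z)
      \<longleftrightarrow> Q = [:0, 1:] * P n m"
    using poly_map_poly_of_real_inject by blast
  also have "\<dots> \<longleftrightarrow> (\<forall>x. poly Q x = poly ([:0, 1:] * P n m) x)"
    by (simp only: poly_eq_poly_eq_iff [symmetric] fun_eq_iff)
  finally show ?thesis
    unfolding lhs rhs by (simp add: Q_def)
qed

text \<open>Averaging the two nearest neighbour recurrences gives the eigenvalue equation.\<close>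

lemma cross_diff_op_iff_nearest_neighbour:
  assumes a0: "\<And>m. a 0 m = 0" and b0: "\<And>n. b n 0 = 0"
    and step: "\<And>n m. P n (m + 1) = P (n + 1) m + Polynomial.smult (2 * h n m) (P n m)"
  shows "(\<forall>z n m. cross_diff_op a b q (\<lambda>i j. poly (map_poly complex_of_real (P i j)) z) n m
      = z * poly (map_poly complex_of_real (P n m)) z) \<longleftrightarrow>
    nearest_neighbour a b (\<lambda>n m. q n m + h n m) (\<lambda>n m. q n m - h n m) P"
proof -
  have "(\<forall>z. cross_diff_op a b q (\<lambda>i j. poly (map_poly complex_of_real (P i j)) z) n m
      = z * poly (map_poly complex_of_real (P n m)) z) \<longleftrightarrow>
    [:0, 1:] * P n m = P (n + 1) m + Polynomial.smult (q n m + h n m) (P n m)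
       + Polynomial.smult (a n m) (P (n - 1) m) + Polynomial.smult (b n m) (P n (m - 1))" for n m
    unfolding cross_diff_op_poly_iff [of a b, OF a0 b0] poly_eq_poly_eq_iff [symmetric] fun_eq_iff step
    by (auto simp: algebra_simps)
  moreover have "2 * h n m = q n m + h n m - (q n m - h n m)" for n m
    by simp
  ultimately show ?thesis
    unfolding nearest_neighbour_def using step by metis
qed

text \<open>The difference \<open>P n (m + 1) - P (n + 1) m\<close> has degree at most
  \<open>n + m\<close> and satisfies the orthogonality conditions of \<open>(n, m)\<close>, so
  normality makes it a multiple of \<open>P n m\<close>. If it were 0, the common polynomial of
  degree \<open>n + m + 1\<close> would violate normality of \<open>(n + 1, m + 1)\<close>.\<close>

lemma mop_difference:
  assumes fin: "finite_moments_measure \<mu>1" "finite_moments_measure \<mu>2"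
    and normal: "\<And>n m. normal_index \<mu>1 \<mu>2 n m"
    and mop: "\<And>n m. type_II_mop \<mu>1 \<mu>2 n m (P n m)"
  shows "\<exists>k. k \<noteq> 0 \<and> P n (m + 1) = P (n + 1) m + Polynomial.smult k (P n m)"
proof -
  have monic: "degree (P n m) = n + m" "coeff (P n m) (n + m) = 1" for n m
    using mop [of n m] by (auto simp: type_II_mop_def)
  have orth1: "poly_functional (moment \<mu>1) (P n m * monom 1 j) = 0" if "j < n" for n m j
    using mop [of n m] that unfolding type_II_mop_def integral_poly_mult_power [OF fin(1)] by blast
  have orth2: "poly_functional (moment \<mu>2) (P n m * monom 1 j) = 0" if "j < m" for n m j
    using mop [of n m] that unfolding type_II_mop_def integral_poly_mult_power [OF fin(2)] by blast
  note only_zero = only_zero_orthogonalD [OF normal [unfolded normal_index_iff]]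
  \<comment> \<open>This choice cancels the coefficient of order \<open>n + m\<close>, as
    \<open>P n m\<close> is monic.\<close>
  define k where "k = coeff (P n (m + 1)) (n + m) - coeff (P (n + 1) m) (n + m)"
  have "P n (m + 1) - P (n + 1) m - Polynomial.smult k (P n m) = 0"
  proof (rule only_zero)
    fix i
    assume "n + m \<le> i"
    then consider "i = n + m" | "i = n + m + 1" | "n + m + 1 < i"
      by linarith
    then show "coeff (P n (m + 1) - P (n + 1) m - Polynomial.smult k (P n m)) i = 0"
    proof cases
      case 2
      then show ?thesis
        using monic [of n "m + 1"] monic [of "n + 1" m] monic [of n m] by (simp add: coeff_eq_0)
    qed (simp_all add: k_def monic coeff_eq_0)
  qed (simp_all add: left_diff_distrib poly_functional_diff poly_functional_smult orth1 orth2)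
  then have eq: "P n (m + 1) = P (n + 1) m + Polynomial.smult k (P n m)"
    by (simp add: algebra_simps)
  moreover have "k \<noteq> 0"
  proof
    assume "k = 0"
    with eq have same: "P n (m + 1) = P (n + 1) m"
      by simp
    have "P n (m + 1) = 0"
    proof (rule only_zero)
      show "coeff (P n (m + 1)) i = 0" if "(n + 1) + (m + 1) \<le> i" for i
        using that by (simp add: coeff_eq_0 monic)
      show "poly_functional (moment \<mu>1) (P n (m + 1) * monom 1 j) = 0" if "j < n + 1" for j
        unfolding same using that by (rule orth1)
    qed (rule orth2)
    with monic(2) [of n "m + 1"] show False
      by simp
  qed
  ultimately show ?thesis
    by blast
qed

text \<open>Compatibility turns the ratios of \<open>a\<close> and \<open>b\<close> in
  \<open>D_coeff\<close> into ratios of \<open>h\<close>, so \<open>D_coeff a b n m * h n m\<close>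
  is linear in \<open>h\<close>. The first compatibility equation evaluates it as a difference of
  \<open>q\<close>, which is the origin of the formula for \<open>half_gap\<close>.\<close>

lemma compatible_imp_half_gap:
  fixes a b q :: "nat \<Rightarrow> nat \<Rightarrow> real"
  assumes comp: "compatible a b (\<lambda>n m. q n m + h n m) (\<lambda>n m. q n m - h n m)"
    and nz: "\<And>n m. a (Suc n) m \<noteq> 0" "\<And>n m. b n (Suc m) \<noteq> 0" and h: "\<And>n m. h n m \<noteq> 0"
    and D: "\<And>n m. D_coeff a b n m \<noteq> 0"
  shows "h = half_gap a b q"
proof (intro ext)
  fix n m
  have 1: "q n (m + 1) + h n (m + 1) - (q (n + 1) m - h (n + 1) m) = 2 * h n m"
    using comp unfolding compatible_def by simp
  have "a (n + 1) m * h (n + 1) m = a (n + 1) (m + 1) * h n m"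
    using comp [unfolded compatible_def, rule_format, of "n + 1" m] by simp
  then have A: "a (n + 1) (m + 1) / a (n + 1) m = h (n + 1) m / h n m"
    using nz h by (simp add: field_simps)
  have "b n (m + 1) * h n (m + 1) = b (n + 1) (m + 1) * h n m"
    using comp [unfolded compatible_def, rule_format, of n "m + 1"] by simp
  then have B: "b (n + 1) (m + 1) / b n (m + 1) = h n (m + 1) / h n m"
    using nz h by (simp add: field_simps)
  have "D_coeff a b n m * h n m = - 4 * (h (n + 1) m + h n (m + 1)) + 8 * h n m"
    unfolding D_coeff_def A B using h [of n m] by (simp add: field_simps)
  also have "\<dots> = - 4 * (q (n + 1) m - q n (m + 1))"
    using 1 by simp
  finally show "h n m = half_gap a b q n m"
    using D [of n m] by (simp add: half_gap_def field_simps)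
qed

theorem theorem5p1:
  fixes a b q :: "nat \<Rightarrow> nat \<Rightarrow> real"
  assumes "\<forall>m. a 0 m = 0" and "\<forall>n. b n 0 = 0"
    and "\<forall>n>0. a n 0 > 0" and "\<forall>m>0. b 0 m > 0"
    and "\<forall>n m. n \<ge> 1 \<longrightarrow> a n m \<noteq> 0" and "\<forall>n m. m \<ge> 1 \<longrightarrow> b n m \<noteq> 0"
    and "\<forall>n m. q (n + 1) m \<noteq> q n (m + 1)"
    and "\<forall>n m. D_coeff a b n m \<noteq> 0"
  shows "(\<exists>(\<mu>1 :: real measure) (\<mu>2 :: real measure) (P :: nat \<Rightarrow> nat \<Rightarrow> real poly).
            finite_moments_measure \<mu>1 \<and> finite_moments_measure \<mu>2 \<and>
            (\<forall>n m. normal_index \<mu>1 \<mu>2 n m) \<and>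
            (\<forall>n m. type_II_mop \<mu>1 \<mu>2 n m (P n m)) \<and>
            (\<forall>(z :: complex) n m.
               cross_diff_op a b q (\<lambda>i j. poly (map_poly complex_of_real (P i j)) z) n m
               = z * poly (map_poly complex_of_real (P n m)) z))
         \<longleftrightarrow>
         (\<forall>(z :: complex) n m.
            L_matrix a b q z n (m + 1) * M_matrix a b q z n m
            - M_matrix a b q z (n + 1) m * L_matrix a b q z n m = 0\<^sub>m 3 3)"
proof -
  define h where "h = half_gap a b q"
  note a0 = assms(1) [rule_format] and b0 = assms(2) [rule_format] and D = assms(8) [rule_format]
  have nz: "a (Suc n) m \<noteq> 0" "b n (Suc m) \<noteq> 0" for n m
    using assms(5,6) by simp_all
  have h: "h n m \<noteq> 0" for n m
    using assms(7) [rule_format, of n m] D [of n m] by (simp add: h_def half_gap_def)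
  show ?thesis
    unfolding zero_curvature_iff_compatible [of a b, OF a0 b0] h_def [symmetric]
  proof
    assume "\<exists>\<mu>1 \<mu>2 P. finite_moments_measure \<mu>1 \<and> finite_moments_measure \<mu>2 \<and>
            (\<forall>n m. normal_index \<mu>1 \<mu>2 n m) \<and> (\<forall>n m. type_II_mop \<mu>1 \<mu>2 n m (P n m)) \<and>
            (\<forall>(z :: complex) n m.
               cross_diff_op a b q (\<lambda>i j. poly (map_poly complex_of_real (P i j)) z) n m
               = z * poly (map_poly complex_of_real (P n m)) z)"
    then obtain \<mu>1 \<mu>2 P where mops: "finite_moments_measure \<mu>1" "finite_moments_measure \<mu>2"
        "\<And>n m. normal_index \<mu>1 \<mu>2 n m" "\<And>n m. type_II_mop \<mu>1 \<mu>2 n m (P n m)"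
      and cross: "\<forall>(z :: complex) n m.
        cross_diff_op a b q (\<lambda>i j. poly (map_poly complex_of_real (P i j)) z) n m
          = z * poly (map_poly complex_of_real (P n m)) z"
      by blast
    obtain k where k: "\<And>n m. k n m \<noteq> 0"
        "\<And>n m. P n (m + 1) = P (n + 1) m + Polynomial.smult (k n m) (P n m)"
      using mop_difference [OF mops] by metis
    \<comment> \<open>Half of the multiple makes \<open>q + g\<close> and \<open>q - g\<close> the
      coefficients of the two recurrences.\<close>
    define g where "g n m = k n m / 2" for n m
    have "nearest_neighbour a b (\<lambda>n m. q n m + g n m) (\<lambda>n m. q n m - g n m) P"
      using cross_diff_op_iff_nearest_neighbour [of a b, OF a0 b0, of P g q] cross k(2) by (simp add: g_def)
    then have comp: "compatible a b (\<lambda>n m. q n m + g n m) (\<lambda>n m. q n m - g n m)"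
      using a0 b0
    proof (rule compatible_of_nearest_neighbour)
      show "q n m + g n m \<noteq> q n m - g n m" for n m
        using k(1) [of n m] by (simp add: g_def)
      show "degree (P n m) = n + m" "coeff (P n m) (n + m) = 1" for n m
        using mops(4) [of n m] by (auto simp: type_II_mop_def)
    qed
    \<comment> \<open>Here the gap found from the polynomials is identified with the one prescribed
      in the matrices.\<close>
    have "g = h"
      unfolding h_def using comp nz by (rule compatible_imp_half_gap) (simp_all add: g_def k(1) D)
    with comp show "compatible a b (\<lambda>n m. q n m + h n m) (\<lambda>n m. q n m - h n m)"
      by simp
  next
    assume "compatible a b (\<lambda>n m. q n m + h n m) (\<lambda>n m. q n m - h n m)"
    from exists_multiple_orthogonal_polynomials [OF this a0 b0] obtain \<mu>1 \<mu>2 P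
      where mops: "finite_moments_measure \<mu>1" "finite_moments_measure \<mu>2"
        "\<forall>n m. normal_index \<mu>1 \<mu>2 n m" "\<forall>n m. type_II_mop \<mu>1 \<mu>2 n m (P n m)"
      and nn: "nearest_neighbour a b (\<lambda>n m. q n m + h n m) (\<lambda>n m. q n m - h n m) P"
      using assms(3,4) nz h by (auto simp: eq_neg_iff_add_eq_0)
    have "P n (m + 1) = P (n + 1) m + Polynomial.smult (2 * h n m) (P n m)" for n m
      using nearest_neighbourD(2) [OF nn, of n m] by simp
    with nn mops show "\<exists>\<mu>1 \<mu>2 P. finite_moments_measure \<mu>1 \<and> finite_moments_measure \<mu>2 \<and>
            (\<forall>n m. normal_index \<mu>1 \<mu>2 n m) \<and> (\<forall>n m. type_II_mop \<mu>1 \<mu>2 n m (P n m)) \<and>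
            (\<forall>(z :: complex) n m.
               cross_diff_op a b q (\<lambda>i j. poly (map_poly complex_of_real (P i j)) z) n m
               = z * poly (map_poly complex_of_real (P n m)) z)"
      using cross_diff_op_iff_nearest_neighbour [of a b, OF a0 b0, of P h q] by blast
  qed
qed

end
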